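(* Assume that the policy is proper, that $\Phi_J$ has rank $l_J$ and $\Phi_M$ has rank $l_M$, and that $q(x)>0$ for all $x\in X$. Let the positive step sizes $\{\xi_k\}_{k\ge 0}$ satisfy $$\sum_{k=0}^\infty \xi_k=\infty,\qquad \sum_{k=0}^\infty\xi_k^2<\infty.$$ Then the TD(0) iterates satisfy $\hat w_{J;k}\to w^*_J$ and $\hat w_{M;k}\to w^*_M$ as $k\to\infty$, with probability 1.
   Context: Setting. $X=\{1,\dots,n\}$ is a finite state set and $x^*\notin X$ is an absorbing terminal state. A fixed policy induces a time-homogeneous Markov chain $(x_k)_{k\ge0}$ on $X\cup\{x^*\}$ with transition probabilities $P(y|x)$, $x\in X$, $y\in X\cup\{x^*\}$. The reward is a deterministic function $r:X\to\mathbb{R}$. The policy is proper if, from every initial state, there is positive probability that $x^*$ is reached after at most $n$ transitions. Let $\tau=\min\{k>0: x_k=x^*\}$. Let $P\in\mathbb{R}^{n\times n}$ be the matrix $P_{x,y}=P(y|x)$, $x,y\in X$ (the terminal state is excluded), let $r\in\mathbb{R}^n$ also denote the reward vector, and $R=\mathrm{diag}(r)$. Occupancy weights. The initial state $x_0$ is drawn from a fixed distribution $\zeta_0$ on $X$. Let $q_t(x)=\mathrm{Prob}(x_t=x)$, $q(x)=\sum_{t=0}^\infty q_t(x)$ for $x\in X$, and $\|y\|_q=\sqrt{\sum_{i=1}^n q(i)y(i)^2}$ for $y\in\mathbb{R}^n$. Features. $\phi_J(x)\in\mathbb{R}^{l_J}$ and $\phi_M(x)\in\mathbb{R}^{l_M}$,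 $x\in X$, are feature vectors; $\Phi_J\in\mathbb{R}^{n\times l_J}$, $\Phi_M\in\mathbb{R}^{n\times l_M}$ are the matrices with rows $\phi_J(x)^T$, $\phi_M(x)^T$. By convention $\phi_J(x^* )=0$ and $\phi_M(x^* )=0$. Let $S_J=\{\Phi_Jw:w\in\mathbb{R}^{l_J}\}$, $S_M=\{\Phi_Mw:w\in\mathbb{R}^{l_M}\}$, and let $\Pi_J,\Pi_M$ be the orthogonal projections of $\mathbb{R}^n$ onto $S_J,S_M$ with respect to $\|\cdot\|_q$. Target weights. Under the first three hypotheses of the claim there is a unique pair $(w^*_J,w^*_M)\in\mathbb{R}^{l_J}\times\mathbb{R}^{l_M}$ such that $$\Pi_J(r+P\Phi_Jw^*_J)=\Phi_Jw^*_J,\qquad \Pi_M(Rr+2RP\Phi_Jw^*_J+P\Phi_Mw^*_M)=\Phi_Mw^*_M.$$ TD(0) algorithm. Simulate independent trajectories $x^k_0,x^k_1,\dots,x^k_{\tau^k-1},x^k_{\tau^k}=x^*$, $k=0,1,2,\dots$, each distributed as the chain started from $\zeta_0$ and run until its terminal time $\tau^k$. For $0\le t<\tau^k$ and weights $w_J\in\mathbb{R}^{l_J},w_M\in\mathbb{R}^{l_M}$ define $$\delta_J^k(t,w_J,w_M)=r(x^k_t)+\big(\phi_J(x^k_{t+1})^T-\phi_J(x^k_t)^T\big)w_J,$$ $$\delta_M^k(t,w_J,w_M)=r(x^k_t)^2+2r(x^k_t)\phi_J(x^k_{t+1})^Tw_J+\big(\phi_M(x^k_{t+1})^T-\phi_M(x^k_t)^T\big)w_M.$$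 Starting from arbitrary deterministic initial weights $\hat w_{J;0},\hat w_{M;0}$, and with deterministic positive step sizes $\xi_k$, the TD(0) iterates are $$\hat w_{J;k+1}=\hat w_{J;k}+\xi_k\sum_{t=0}^{\tau^k-1}\phi_J(x^k_t)\,\delta_J^k(t,\hat w_{J;k},\hat w_{M;k}),$$ $$\hat w_{M;k+1}=\hat w_{M;k}+\xi_k\sum_{t=0}^{\tau^k-1}\phi_M(x^k_t)\,\delta_M^k(t,\hat w_{J;k},\hat w_{M;k}).$$ *)

theory Defs
  imports "HOL-Probability.Probability"
begin

text \<open>
  The state set \<open>X = {1,...,n}\<close> is a finite type \<open>'n\<close> with \<open>n = CARD('n)\<close>. The chain
  lives on \<open>'n option\<close>, where \<open>Some x\<close> is a state of \<open>X\<close> and \<open>None\<close> is the terminal state.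
  \<open>K x\<close> is the distribution of the successor of \<open>x \<in> X\<close>.
\<close>

definition step :: "('n \<Rightarrow> 'n option pmf) \<Rightarrow> 'n option \<Rightarrow> 'n option pmf" where
  "step K s = (case s of None \<Rightarrow> return_pmf None | Some x \<Rightarrow> K x)"

text \<open>The joint law of \<open>(x\<^sub>0,...,x\<^sub>t)\<close>, first for \<open>x\<^sub>0 = s\<close>, then for \<open>x\<^sub>0\<close> drawn from \<open>\<zeta>\<^sub>0\<close>.\<close>

primrec path_pmf :: "('n \<Rightarrow> 'n option pmf) \<Rightarrow> nat \<Rightarrow> 'n option \<Rightarrow> 'n option list pmf" where
  "path_pmf K 0 s = return_pmf [s]"
| "path_pmf K (Suc t) s = bind_pmf (step K s) (\<lambda>s'. map_pmf ((#) s) (path_pmf K t s'))"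

definition init_path_pmf :: "'n pmf \<Rightarrow> ('n \<Rightarrow> 'n option pmf) \<Rightarrow> nat \<Rightarrow> 'n option list pmf" where
  "init_path_pmf \<zeta>0 K t = bind_pmf \<zeta>0 (\<lambda>x. path_pmf K t (Some x))"

definition proper :: "('n::finite \<Rightarrow> 'n option pmf) \<Rightarrow> bool" where
  "proper K \<longleftrightarrow>
    (\<forall>x. measure_pmf.prob (path_pmf K CARD('n) (Some x)) {xs. None \<in> set xs} > 0)"

definition markov_chain ::
  "'a measure \<Rightarrow> 'n pmf \<Rightarrow> ('n \<Rightarrow> 'n option pmf) \<Rightarrow> (nat \<Rightarrow> 'a \<Rightarrow> 'n option) \<Rightarrow> bool" where
  "markov_chain M \<zeta>0 K Y \<longleftrightarrow>
    (\<forall>t. Y t \<in> measurable M (count_space UNIV)) \<and>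
    (\<forall>t. distr M (count_space UNIV) (\<lambda>\<omega>. map (\<lambda>i. Y i \<omega>) [0..<Suc t])
          = measure_pmf (init_path_pmf \<zeta>0 K t))"

definition trans_mat :: "('n \<Rightarrow> 'n option pmf) \<Rightarrow> real^'n^'n" where
  "trans_mat K = (\<chi> x y. pmf (K x) (Some y))"

definition diag_mat :: "real^'n \<Rightarrow> real^'n^'n" where
  "diag_mat r = (\<chi> x y. if x = y then r $ x else 0)"

definition occ_at :: "'n pmf \<Rightarrow> ('n \<Rightarrow> 'n option pmf) \<Rightarrow> nat \<Rightarrow> 'n \<Rightarrow> real" where
  "occ_at \<zeta>0 K t x = measure_pmf.prob (init_path_pmf \<zeta>0 K t) {xs. xs ! t = Some x}"

text \<open>For a proper chain the series below converges.\<close>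

definition occ :: "'n pmf \<Rightarrow> ('n \<Rightarrow> 'n option pmf) \<Rightarrow> 'n \<Rightarrow> real" where
  "occ \<zeta>0 K x = (\<Sum>t. occ_at \<zeta>0 K t x)"

definition winner :: "('n::finite \<Rightarrow> real) \<Rightarrow> real^'n \<Rightarrow> real^'n \<Rightarrow> real" where
  "winner q y z = (\<Sum>i\<in>UNIV. q i * y $ i * z $ i)"

definition wnorm :: "('n::finite \<Rightarrow> real) \<Rightarrow> real^'n \<Rightarrow> real" where
  "wnorm q y = sqrt (\<Sum>i\<in>UNIV. q i * (y $ i)\<^sup>2)"

definition wproj :: "('n::finite \<Rightarrow> real) \<Rightarrow> (real^'n) set \<Rightarrow> real^'n \<Rightarrow> real^'n" where
  "wproj q S y = (THE z. z \<in> S \<and> (\<forall>s\<in>S. winner q (y - z) s = 0))"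

text \<open>The inner product induces the norm, and orthogonality of the error is the same as
  being a nearest point in that norm.\<close>

lemma wnorm_eq_sqrt_winner: "wnorm q y = sqrt (winner q y y)"
  by (simp add: wnorm_def winner_def power2_eq_square mult.assoc)

lemma orthogonal_iff_nearest:
  assumes q: "\<And>i. q i > 0" and S: "subspace S" and z: "z \<in> S"
  shows "(\<forall>s\<in>S. winner q (y - z) s = 0) \<longleftrightarrow> (\<forall>s\<in>S. wnorm q (y - z) \<le> wnorm q (y - s))"
proof
  have exp: "winner q (u + a *\<^sub>R v) (u + a *\<^sub>R v)
      = winner q u u + 2 * a * winner q u v + a\<^sup>2 * winner q v v" for u v a
    by (simp add: winner_def sum_distrib_left sum.distrib[symmetric] algebra_simps power2_eq_square)
  have pos: "winner q v v \<ge> 0" for v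
    unfolding winner_def using q by (intro sum_nonneg) (simp add: mult.assoc less_imp_le)
  {
    assume o: "\<forall>s\<in>S. winner q (y - z) s = 0"
    show "\<forall>s\<in>S. wnorm q (y - z) \<le> wnorm q (y - s)"
    proof
      fix s assume "s \<in> S"
      then have "z - s \<in> S" using S z by (simp add: subspace_diff)
      then show "wnorm q (y - z) \<le> wnorm q (y - s)"
        using exp[of "y - z" 1 "z - s"] o pos[of "z - s"] by (simp add: wnorm_eq_sqrt_winner)
    qed
  next
    assume m: "\<forall>s\<in>S. wnorm q (y - z) \<le> wnorm q (y - s)"
    show "\<forall>s\<in>S. winner q (y - z) s = 0"
    proof
      fix s assume s: "s \<in> S"
      define b c where "b = winner q (y - z) s" and "c = winner q s s"
      have ineq: "0 \<le> 2 * a * b + a\<^sup>2 * c" for a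
      proof -
        have "z - a *\<^sub>R s \<in> S" using S z s by (simp add: subspace_diff subspace_scale)
        then have "wnorm q (y - z) \<le> wnorm q (y - (z - a *\<^sub>R s))" using m by blast
        moreover have "y - (z - a *\<^sub>R s) = (y - z) + a *\<^sub>R s" by simp
        ultimately show ?thesis using exp[of "y - z" a s]
          by (simp add: wnorm_eq_sqrt_winner b_def c_def)
      qed
      have c: "c \<ge> 0" using pos c_def by simp
      define a where "a = - b / (c + 1)"
      have b: "b = - a * (c + 1)" using c by (simp add: a_def)
      have "0 \<le> 2 * a * b + a\<^sup>2 * c" by (rule ineq)
      also have "\<dots> = - (a\<^sup>2 * (c + 2))"
        unfolding b by (simp add: algebra_simps power2_eq_square)
      finally have "a\<^sup>2 * (c + 2) \<le> 0" by simp
      then have "a = 0" using c by (simp add: mult_le_0_iff)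
      then show "winner q (y - z) s = 0" using b by (simp add: b_def)
    qed
  }
qed

definition feature_mat :: "('n \<Rightarrow> real^'l) \<Rightarrow> real^'l^'n" where
  "feature_mat \<phi> = (\<chi> x. \<phi> x)"

definition feature_space :: "('n \<Rightarrow> real^'l) \<Rightarrow> (real^'n) set" where
  "feature_space \<phi> = range (\<lambda>w. feature_mat \<phi> *v w)"

definition is_td_target ::
  "'n::finite pmf \<Rightarrow> ('n \<Rightarrow> 'n option pmf) \<Rightarrow> real^'n \<Rightarrow> ('n \<Rightarrow> real^'j) \<Rightarrow> ('n \<Rightarrow> real^'m)
    \<Rightarrow> (real^'j) \<times> (real^'m) \<Rightarrow> bool" where
  "is_td_target \<zeta>0 K r \<phi>J \<phi>M = (\<lambda>(wJ, wM).
    let q = occ \<zeta>0 K; P = trans_mat K; R = diag_mat r;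
        \<Phi>J = feature_mat \<phi>J; \<Phi>M = feature_mat \<phi>M
    in wproj q (feature_space \<phi>J) (r + P *v (\<Phi>J *v wJ)) = \<Phi>J *v wJ \<and>
       wproj q (feature_space \<phi>M)
         (R *v r + 2 *\<^sub>R (R *v (P *v (\<Phi>J *v wJ))) + P *v (\<Phi>M *v wM)) = \<Phi>M *v wM)"

definition td_target ::
  "'n::finite pmf \<Rightarrow> ('n \<Rightarrow> 'n option pmf) \<Rightarrow> real^'n \<Rightarrow> ('n \<Rightarrow> real^'j) \<Rightarrow> ('n \<Rightarrow> real^'m)
    \<Rightarrow> (real^'j) \<times> (real^'m)" where
  "td_target \<zeta>0 K r \<phi>J \<phi>M = (THE w. is_td_target \<zeta>0 K r \<phi>J \<phi>M w)"

text \<open>Values at the terminal state: features are \<open>0\<close> by convention; the reward there is never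
  used, since the updates only involve rewards at times before termination.\<close>

definition feature_at :: "('n \<Rightarrow> real^'l) \<Rightarrow> 'n option \<Rightarrow> real^'l" where
  "feature_at \<phi> s = (case s of None \<Rightarrow> 0 | Some x \<Rightarrow> \<phi> x)"

definition reward_at :: "real^'n \<Rightarrow> 'n option \<Rightarrow> real" where
  "reward_at r s = (case s of None \<Rightarrow> 0 | Some x \<Rightarrow> r $ x)"

definition term_time :: "(nat \<Rightarrow> 'n option) \<Rightarrow> enat" where
  "term_time x = Inf (enat ` {k. k > 0 \<and> x k = None})"

definition delta_J ::
  "real^'n \<Rightarrow> ('n \<Rightarrow> real^'j) \<Rightarrow> (nat \<Rightarrow> 'n option) \<Rightarrow> nat \<Rightarrow> real^'j \<Rightarrow> real" where
  "delta_J r \<phi>J x t wJ =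
    reward_at r (x t) + (feature_at \<phi>J (x (Suc t)) - feature_at \<phi>J (x t)) \<bullet> wJ"

definition delta_M ::
  "real^'n \<Rightarrow> ('n \<Rightarrow> real^'j) \<Rightarrow> ('n \<Rightarrow> real^'m) \<Rightarrow> (nat \<Rightarrow> 'n option) \<Rightarrow> nat
    \<Rightarrow> real^'j \<Rightarrow> real^'m \<Rightarrow> real" where
  "delta_M r \<phi>J \<phi>M x t wJ wM =
    (reward_at r (x t))\<^sup>2 + 2 * reward_at r (x t) * (feature_at \<phi>J (x (Suc t)) \<bullet> wJ)
      + (feature_at \<phi>M (x (Suc t)) - feature_at \<phi>M (x t)) \<bullet> wM"

text \<open>\<open>x k\<close> is the \<open>k\<close>-th trajectory. A trajectory that never terminates (a null event for a
  proper chain) contributes a sum over an infinite set, which is \<open>0\<close> by convention.\<close>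

primrec td_iter ::
  "real^'n \<Rightarrow> ('n \<Rightarrow> real^'j) \<Rightarrow> ('n \<Rightarrow> real^'m) \<Rightarrow> (nat \<Rightarrow> real) \<Rightarrow> (real^'j) \<times> (real^'m)
    \<Rightarrow> (nat \<Rightarrow> nat \<Rightarrow> 'n option) \<Rightarrow> nat \<Rightarrow> (real^'j) \<times> (real^'m)" where
  "td_iter r \<phi>J \<phi>M \<xi> w0 x 0 = w0"
| "td_iter r \<phi>J \<phi>M \<xi> w0 x (Suc k) =
    (let (wJ, wM) = td_iter r \<phi>J \<phi>M \<xi> w0 x k; T = {t. enat t < term_time (x k)} in
      (wJ + \<xi> k *\<^sub>R (\<Sum>t\<in>T. delta_J r \<phi>J (x k) t wJ *\<^sub>R feature_at \<phi>J (x k t)),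
       wM + \<xi> k *\<^sub>R (\<Sum>t\<in>T. delta_M r \<phi>J \<phi>M (x k) t wJ wM *\<^sub>R feature_at \<phi>M (x k t))))"

end

theory Submission
  imports Defs
begin

text \<open>
  One trajectory moves \<open>w\<close> by \<open>\<xi> G(w, y)\<close> where \<open>G\<close> is affine in \<open>w\<close>, has mean zero at the target,
  and satisfies \<open>\<parallel>G(w, y)\<parallel> \<le> A (1 + \<parallel>w\<parallel>) \<tau>\<close>; \<open>E \<tau>\<^sup>2\<close> is finite because the survival probabilities
  of a proper chain decay geometrically. The identity \<open>q = \<zeta>\<^sub>0 + P\<^sup>T q\<close> makes \<open>P\<close> a contraction in
  \<open>\<parallel>\<cdot>\<parallel>\<^sub>q\<close>, and \<open>P h = h\<close> forces \<open>h = 0\<close>, so both diagonal blocks of the mean drift are negative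
  definite. The mean drift is block triangular, hence
  \<open>V(w) = \<parallel>w\<^sub>J - w\<^sub>J\<^sup>*\<parallel>\<^sup>2 + \<kappa> \<parallel>w\<^sub>M - w\<^sub>M\<^sup>*\<parallel>\<^sup>2\<close> with small \<open>\<kappa>\<close> satisfies
  \<open>E V(w\<^sub>k\<^sub>+\<^sub>1) \<le> (1 - 2 c \<xi>\<^sub>k + C \<xi>\<^sub>k\<^sup>2) V(w\<^sub>k) + C \<xi>\<^sub>k\<^sup>2\<close> conditionally on the past. This gives
  \<open>E V(w\<^sub>k) \<longlonglongrightarrow> 0\<close>, and the maximal inequality for a nonnegative supermartingale built from \<open>V\<close>
  turns it into almost sure convergence.
\<close>

section \<open>Lyapunov functions for recursions with independent inputs\<close>

text \<open>No conditional expectation is formed. The drift bound is proved for every fixed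
  \<open>w\<close> and a single trajectory; the state before step \<open>k\<close> is a function of
  the earlier trajectories only, so Tonelli on the product law of past and present puts the random
  state in place of \<open>w\<close>. The update does not vanish at the target, only its mean does.
  Its noise leaves an additive \<open>C * (\<xi> k)\<^sup>2\<close>, so \<open>V\<close> alone is no
  supermartingale: it is divided by the accumulated factors
  \<open>1 + C * (\<xi> i)\<^sup>2\<close>, and the noise still to come is added in advance. The two
  step-size conditions act separately. Summable squares keep the discount and the noise bounded;
  divergence of the sum of \<open>\<xi>\<close> drives the means of \<open>V\<close> to 0. The
  maximal inequality can be started at any time \<open>m\<close>, where its bound is a mean that is
  already small. The bound on \<open>P\<close> in the weighted norm is weak. Strict negativity of
  the diagonal blocks comes from the term \<open>\<parallel>h - P h\<parallel>\<close> in a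
  polarisation identity. The cross term from \<open>w_J\<close> into the \<open>M\<close> block has
  no sign and is absorbed by the \<open>J\<close> block, which dictates the size of
  \<open>\<kappa>\<close>.\<close>

definition discount :: "(nat \<Rightarrow> real) \<Rightarrow> nat \<Rightarrow> real" where
  "discount b k = (\<Prod>i<k. 1 + b i)"

definition tail_sum :: "(nat \<Rightarrow> real) \<Rightarrow> nat \<Rightarrow> real" where
  "tail_sum b k = (\<Sum>i. b (i + k))"

context
  fixes b :: "nat \<Rightarrow> real"
  assumes b: "\<And>k. 0 \<le> b k" "summable b"
begin

lemma discount_ge_1: "1 \<le> discount b k"
  unfolding discount_def using b by (intro prod_ge_1) simp

lemma discount_le: "discount b k \<le> exp (suminf b)"
proof -
  have "discount b k \<le> (\<Prod>i<k. exp (b i))"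
    unfolding discount_def using b by (intro prod_mono) (auto simp: add_nonneg_nonneg)
  also have "\<dots> = exp (\<Sum>i<k. b i)" by (simp add: exp_sum)
  also have "\<dots> \<le> exp (suminf b)" using b by (simp add: sum_le_suminf)
  finally show ?thesis .
qed

lemma tail_sum_nonneg: "0 \<le> tail_sum b k"
  unfolding tail_sum_def using b by (intro suminf_nonneg) (auto simp: summable_iff_shift)

lemma tail_sum_Suc: "tail_sum b k = b k + tail_sum b (Suc k)"
  using suminf_split_head[of "\<lambda>i. b (i + k)"] b by (simp add: tail_sum_def summable_iff_shift)

lemma tail_sum_tendsto: "tail_sum b \<longlonglongrightarrow> 0"
  unfolding tail_sum_def using suminf_exist_split2[OF b(2)] by simp

text \<open>
  If \<open>v\<close> evolves by \<open>v \<mapsto> (1 - a\<^sub>k + b\<^sub>k) v + b\<^sub>k\<close>, then \<open>v / discount b k + tail_sum b k\<close> decreases; applied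
  to conditional expectations, this is a supermartingale.
\<close>

lemma discounted_drift:
  assumes "0 \<le> v"
  shows "((1 - a + b k) * v + b k) / discount b (Suc k) + tail_sum b (Suc k)
    \<le> v / discount b k + tail_sum b k - a * v / discount b (Suc k)"
proof -
  have S: "discount b (Suc k) = (1 + b k) * discount b k" by (simp add: discount_def)
  have p: "discount b k > 0" "discount b (Suc k) \<ge> 1" "1 + b k > 0"
    using discount_ge_1[of k] discount_ge_1[of "Suc k"] b(1)[of k] by auto
  have "((1 - a + b k) * v + b k) / discount b (Suc k)
      = (1 + b k) * v / discount b (Suc k) - a * v / discount b (Suc k) + b k / discount b (Suc k)"
    by (simp add: field_simps add_divide_distrib diff_divide_distrib)
  moreover have "(1 + b k) * v / discount b (Suc k) = v / discount b k"
    using p by (simp add: S)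
  moreover have "b k / discount b (Suc k) \<le> b k"
    using p mult_left_mono[OF p(2) b(1)[of k]] by (simp add: divide_le_eq)
  ultimately show ?thesis using tail_sum_Suc[of k] by linarith
qed

text \<open>The discounted sequence \<open>u\<close> decreases by at least a multiple of
  \<open>a k * v k\<close> in each step, so these products are summable. A positive limit would keep
  \<open>v\<close> away from 0 and make \<open>a\<close> itself summable.\<close>

lemma perturbed_contraction_tendsto_0:
  fixes v a :: "nat \<Rightarrow> real"
  assumes a: "\<And>k. 0 \<le> a k" "\<not> summable a"
    and v: "\<And>k. 0 \<le> v k" "\<And>k. v (Suc k) \<le> (1 - a k + b k) * v k + b k"
  shows "v \<longlonglongrightarrow> 0"
proof -
  let ?P = "exp (suminf b)"
  define u where "u k = v k / discount b k + tail_sum b k" for k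
  have p: "0 < discount b k" for k using discount_ge_1[of k] by simp
  have u0: "0 \<le> u k" for k
    unfolding u_def using v(1) p tail_sum_nonneg by (simp add: less_imp_le)
  have dec: "u (Suc k) \<le> u k - a k * v k / ?P" for k
  proof -
    have "u (Suc k) \<le> ((1 - a k + b k) * v k + b k) / discount b (Suc k) + tail_sum b (Suc k)"
      unfolding u_def using v(2) p by (simp add: divide_right_mono less_imp_le)
    also have "\<dots> \<le> u k - a k * v k / discount b (Suc k)"
      unfolding u_def using discounted_drift v(1) by blast
    \<comment> \<open>The varying discount is replaced by its uniform upper bound, so that one
      constant serves in the summed decrements.\<close>
    also have "\<dots> \<le> u k - a k * v k / ?P"
      using a v(1) p discount_le by (intro diff_left_mono divide_left_mono) auto
    finally show ?thesis .
  qed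
  have av: "0 \<le> a k * v k / ?P" for k using a v by simp
  have "decseq u" using dec av by (intro decseq_SucI) (meson diff_le_eq le_add_same_cancel1 order_trans)
  then obtain L where L: "u \<longlonglongrightarrow> L" using decseq_convergent u0 by metis
  have "(\<Sum>i<k. a i * v i / ?P) \<le> u 0 - u k" for k
  proof (induction k)
    case (Suc k) then show ?case using dec[of k] by simp
  qed simp
  then have "(\<Sum>i<k. a i * v i / ?P) \<le> u 0" for k using u0[of k] by (smt (verit))
  then have sm: "summable (\<lambda>i. a i * v i / ?P)"
    using av by (intro summableI_nonneg_bounded) auto
  have q: "(\<lambda>k. v k / discount b k) \<longlonglongrightarrow> L"
    using tendsto_diff[OF L tail_sum_tendsto] by (simp add: u_def)
  have "L \<ge> 0" using q v(1) p by (intro LIMSEQ_le_const[OF q]) (auto simp: less_imp_le)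
  moreover have "\<not> L > 0"
  proof
    assume "L > 0"
    then have "\<forall>\<^sub>F k in sequentially. v k / discount b k > L / 2"
      using order_tendstoD(1)[OF q, of "L / 2"] by simp
    then have "\<forall>\<^sub>F k in sequentially. norm (a k) \<le> (2 * ?P / L) * (a k * v k / ?P)"
    proof eventually_elim
      case (elim k)
      have "L / 2 \<le> v k"
      proof -
        have "v k / discount b k \<le> v k"
          using p[of k] mult_left_mono[OF discount_ge_1[of k] v(1)[of k]] by (simp add: divide_le_eq)
        then show ?thesis using elim by linarith
      qed
      then have "a k * (L / 2) \<le> a k * v k" using a by (intro mult_left_mono) auto
      then show ?case using \<open>L > 0\<close> a by (simp add: field_simps)
    qed
    then have "summable a"
      using summable_mult[OF sm] by (rule summable_comparison_test_ev)
    with a show False by simp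
  qed
  ultimately have "L = 0" by simp
  have "(\<lambda>k. ?P * (v k / discount b k)) \<longlonglongrightarrow> ?P * 0"
    using q \<open>L = 0\<close> by (intro tendsto_intros) auto
  moreover have "v k \<le> ?P * (v k / discount b k)" for k
    using p[of k] mult_left_mono[OF discount_le[of k] v(1)[of k]] by (simp add: field_simps)
  ultimately show ?thesis
    using v(1) by (intro tendsto_sandwich[of "\<lambda>_. 0" v sequentially]) (auto intro: always_eventually)
qed

end

section \<open>Recursions driven by independent inputs\<close>

text \<open>A deterministic function of the whole input sequence: its value at \<open>k\<close>
  reads only \<open>y\<close> below \<open>k\<close>, so it factors through the restriction to
  \<open>{..<k}\<close>, the form in which independence of past and present is available.\<close>

primrec drive :: "(nat \<Rightarrow> 'w \<Rightarrow> 'b \<Rightarrow> 'w) \<Rightarrow> 'w \<Rightarrow> (nat \<Rightarrow> 'b) \<Rightarrow> nat \<Rightarrow> 'w" where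
  "drive F w0 y 0 = w0"
| "drive F w0 y (Suc k) = F k (drive F w0 y k) (y k)"

lemma drive_cong: "(\<And>i. i < k \<Longrightarrow> y i = y' i) \<Longrightarrow> drive F w0 y k = drive F w0 y' k"
  by (induction k) auto

lemma drive_restrict: "j \<le> k \<Longrightarrow> drive F w0 (restrict y {..<k}) j = drive F w0 y j"
  by (rule drive_cong) auto

lemma measurable_drive:
  assumes F: "\<And>k. (\<lambda>(w, y). F k w y) \<in> measurable (S \<Otimes>\<^sub>M N) S"
    and w0: "w0 \<in> space S" and "j \<le> k"
  shows "(\<lambda>y. drive F w0 y j) \<in> measurable (PiM {..<k} (\<lambda>_. N)) S"
  using \<open>j \<le> k\<close>
proof (induction j)
  case (Suc j)
  then have "(\<lambda>y. (drive F w0 y j, y j)) \<in> measurable (PiM {..<k} (\<lambda>_. N)) (S \<Otimes>\<^sub>M N)"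
    by (intro measurable_Pair measurable_component_singleton) auto
  from measurable_comp[OF this F[of j]] show ?case by (simp add: o_def)
qed (simp add: w0)

context prob_space begin

text \<open>Stands in for conditioning on the past: the joint law of past and present is a product,
  so by Tonelli the past may be frozen at \<open>\<omega>'\<close> while the present is
  integrated.\<close>

lemma nn_integral_past_present:
  assumes ind: "indep_vars (\<lambda>_. N) Y (UNIV :: nat set)"
    and h: "h \<in> borel_measurable (PiM {..<k} (\<lambda>_. N) \<Otimes>\<^sub>M N)"
  shows "(\<integral>\<^sup>+\<omega>. h (restrict (\<lambda>i. Y i \<omega>) {..<k}, Y k \<omega>) \<partial>M)
    = (\<integral>\<^sup>+\<omega>'. \<integral>\<^sup>+\<omega>. h (restrict (\<lambda>i. Y i \<omega>') {..<k}, Y k \<omega>) \<partial>M \<partial>M)"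
proof -
  let ?X = "\<lambda>\<omega>. restrict (\<lambda>i. Y i \<omega>) {..<k}" and ?S = "PiM {..<k} (\<lambda>_. N)"
  \<comment> \<open>Independence of blocks of indices speaks of restrictions, so the present appears
    as a product over the one index \<open>k\<close>, and \<open>h'\<close> reads off its
    coordinate.\<close>
  let ?Z = "\<lambda>\<omega>. restrict (\<lambda>i. Y i \<omega>) {k}" and ?T = "PiM {k} (\<lambda>_. N)"
  define h' where "h' = (\<lambda>(p, z). h (p, z k))"
  have "indep_var ?S ?X ?T ?Z"
    by (rule indep_var_restrict[OF ind]) auto
  then have mX[measurable]: "?X \<in> measurable M ?S" and mZ[measurable]: "?Z \<in> measurable M ?T"
    and d: "distr M ?S ?X \<Otimes>\<^sub>M distr M ?T ?Z = distr M (?S \<Otimes>\<^sub>M ?T) (\<lambda>\<omega>. (?X \<omega>, ?Z \<omega>))"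
    by (auto simp: indep_var_distribution_eq)
  have "(\<lambda>x. (fst x, snd x k)) \<in> measurable (?S \<Otimes>\<^sub>M ?T) (?S \<Otimes>\<^sub>M N)"
    by (intro measurable_Pair measurable_fst
        measurable_compose[OF measurable_snd measurable_component_singleton]) simp
  from measurable_comp[OF this h]
  have h': "h' \<in> borel_measurable (?S \<Otimes>\<^sub>M ?T)"
    by (simp add: h'_def o_def case_prod_beta)
  then have h'': "h' \<in> borel_measurable (distr M ?S ?X \<Otimes>\<^sub>M distr M ?T ?Z)"
    by (simp cong: measurable_cong_sets sets_pair_measure_cong)
  interpret Z: prob_space "distr M ?T ?Z" by (rule prob_space_distr) fact
  have "(\<integral>\<^sup>+\<omega>. h (?X \<omega>, Y k \<omega>) \<partial>M) = (\<integral>\<^sup>+\<omega>. h' (?X \<omega>, ?Z \<omega>) \<partial>M)"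
    by (simp add: h'_def)
  also have "\<dots> = (\<integral>\<^sup>+z. h' z \<partial>distr M (?S \<Otimes>\<^sub>M ?T) (\<lambda>\<omega>. (?X \<omega>, ?Z \<omega>)))"
    using measurable_Pair[OF mX mZ] h' by (intro nn_integral_distr[symmetric]) auto
  also have "\<dots> = (\<integral>\<^sup>+p. \<integral>\<^sup>+z. h' (p, z) \<partial>distr M ?T ?Z \<partial>distr M ?S ?X)"
    unfolding d[symmetric] by (rule Z.nn_integral_fst[symmetric]) (rule h'')
  also have "\<dots> = (\<integral>\<^sup>+\<omega>'. \<integral>\<^sup>+z. h' (?X \<omega>', z) \<partial>distr M ?T ?Z \<partial>M)"
    by (rule nn_integral_distr[OF mX])
       (use Z.borel_measurable_nn_integral_fst[OF h''] in simp)
  also have "\<dots> = (\<integral>\<^sup>+\<omega>'. \<integral>\<^sup>+\<omega>. h (?X \<omega>', Y k \<omega>) \<partial>M \<partial>M)"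
  proof (rule nn_integral_cong)
    fix \<omega>' assume "\<omega>' \<in> space M"
    then have "?X \<omega>' \<in> space ?S" using mX by (rule measurable_space[rotated])
    from measurable_compose[OF measurable_Pair1'[OF this] h']
    have "(\<integral>\<^sup>+z. h' (?X \<omega>', z) \<partial>distr M ?T ?Z) = (\<integral>\<^sup>+\<omega>. h' (?X \<omega>', ?Z \<omega>) \<partial>M)"
      by (intro nn_integral_distr[OF mZ]) simp
    then show "(\<integral>\<^sup>+z. h' (?X \<omega>', z) \<partial>distr M ?T ?Z) = (\<integral>\<^sup>+\<omega>. h (?X \<omega>', Y k \<omega>) \<partial>M)"
      by (simp add: h'_def)
  qed
  finally show ?thesis .
qed

context
  fixes Y :: "nat \<Rightarrow> 'a \<Rightarrow> 'b" and N :: "'b measure" and S :: "'w measure"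
    and F :: "nat \<Rightarrow> 'w \<Rightarrow> 'b \<Rightarrow> 'w" and w0 :: 'w
  assumes ind: "indep_vars (\<lambda>_. N) Y (UNIV :: nat set)"
    and F: "\<And>k. (\<lambda>(w, y). F k w y) \<in> measurable (S \<Otimes>\<^sub>M N) S"
    and w0: "w0 \<in> space S"
begin

abbreviation "W k \<omega> \<equiv> drive F w0 (\<lambda>i. Y i \<omega>) k"

lemma measurable_input: "Y k \<in> measurable M N"
  using ind unfolding indep_vars_def by blast

lemma measurable_state: "(\<lambda>\<omega>. W k \<omega>) \<in> measurable M S"
proof (induction k)
  case (Suc k)
  have "(\<lambda>\<omega>. (W k \<omega>, Y k \<omega>)) \<in> measurable M (S \<Otimes>\<^sub>M N)"
    using Suc measurable_input by (rule measurable_Pair)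
  from measurable_comp[OF this F[of k]] show ?case by (simp add: o_def)
qed (simp add: w0)

text \<open>\<open>g\<close> is an event decided by the first \<open>k\<close> inputs. With
  \<open>g\<close> constantly true this is the one-step formula for means; with \<open>g\<close> the
  event of not yet having been stopped it handles a process frozen at \<open>c\<close>.\<close>

lemma nn_integral_state_step:
  assumes g: "\<And>\<omega>. g \<omega> = G (restrict (\<lambda>i. Y i \<omega>) {..<k})"
    and G: "Measurable.pred (PiM {..<k} (\<lambda>_. N)) G"
    and U: "U \<in> borel_measurable S"
  shows "(\<integral>\<^sup>+\<omega>. (if g \<omega> then U (W (Suc k) \<omega>) else c) \<partial>M)
    = (\<integral>\<^sup>+\<omega>'. (if g \<omega>' then \<integral>\<^sup>+\<omega>. U (F k (W k \<omega>') (Y k \<omega>)) \<partial>M else c) \<partial>M)"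
proof -
  let ?S = "PiM {..<k} (\<lambda>_. N)"
  let ?h = "\<lambda>(p, y). if G p then U (F k (drive F w0 p k) y) else c"
  have "(\<lambda>z. (drive F w0 (fst z) k, snd z)) \<in> measurable (?S \<Otimes>\<^sub>M N) (S \<Otimes>\<^sub>M N)"
    using measurable_drive[OF F w0 order_refl]
    by (intro measurable_Pair) (auto intro: measurable_compose[OF measurable_fst])
  from measurable_comp[OF measurable_comp[OF this F[of k]] U]
  have [measurable]: "(\<lambda>z. U (F k (drive F w0 (fst z) k) (snd z))) \<in> borel_measurable (?S \<Otimes>\<^sub>M N)"
    by (simp add: o_def)
  note G[measurable]
  have "?h \<in> borel_measurable (?S \<Otimes>\<^sub>M N)" unfolding case_prod_beta by measurable
  note step = nn_integral_past_present[OF ind this]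
  have "(\<integral>\<^sup>+\<omega>. (if g \<omega> then U (W (Suc k) \<omega>) else c) \<partial>M)
      = (\<integral>\<^sup>+\<omega>. ?h (restrict (\<lambda>i. Y i \<omega>) {..<k}, Y k \<omega>) \<partial>M)"
    by (simp add: g drive_restrict cong: if_cong)
  also note step
  also have "(\<integral>\<^sup>+\<omega>'. \<integral>\<^sup>+\<omega>. ?h (restrict (\<lambda>i. Y i \<omega>') {..<k}, Y k \<omega>) \<partial>M \<partial>M)
      = (\<integral>\<^sup>+\<omega>'. (if g \<omega>' then \<integral>\<^sup>+\<omega>. U (F k (W k \<omega>') (Y k \<omega>)) \<partial>M else c) \<partial>M)"
    by (intro nn_integral_cong) (simp add: g drive_restrict emeasure_space_1)
  finally show ?thesis .
qed

lemma supermartingale_maximal: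
  fixes U :: "nat \<Rightarrow> 'w \<Rightarrow> ennreal"
  assumes U: "\<And>k. U k \<in> borel_measurable S"
    and drift: "\<And>k w. w \<in> space S \<Longrightarrow> (\<integral>\<^sup>+\<omega>. U (Suc k) (F k w (Y k \<omega>)) \<partial>M) \<le> U k w"
  shows "\<epsilon> * emeasure M {\<omega>\<in>space M. \<exists>i\<ge>m. \<epsilon> \<le> U i (W i \<omega>)} \<le> (\<integral>\<^sup>+\<omega>. U m (W m \<omega>) \<partial>M)"
proof -
  have UW[measurable]: "(\<lambda>\<omega>. U i (W i \<omega>)) \<in> borel_measurable M" for i
    using measurable_comp[OF measurable_state U] by (simp add: o_def)
  define g where "g n \<omega> \<longleftrightarrow> (\<forall>i\<in>{m..n}. U i (W i \<omega>) < \<epsilon>)" for n \<omega>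
  \<comment> \<open>\<open>Z\<close> is the supermartingale frozen at \<open>\<epsilon>\<close> from the first time it reaches \<open>\<epsilon>\<close>.\<close>
  define Z where "Z n \<omega> = (if g n \<omega> then U n (W n \<omega>) else \<epsilon>)" for n \<omega>
  have Z: "(\<integral>\<^sup>+\<omega>. Z n \<omega> \<partial>M) \<le> (\<integral>\<^sup>+\<omega>. U m (W m \<omega>) \<partial>M)" if "m \<le> n" for n
    using that
  proof (induction n rule: dec_induct)
    case base
    show ?case by (intro nn_integral_mono) (auto simp: Z_def g_def not_less)
  next
    case (step n)
    \<comment> \<open>If the first passage happens exactly at \<open>Suc n\<close>, then
      \<open>U\<close> there is at least \<open>\<epsilon>\<close>. Testing only up to
      \<open>n\<close> can therefore only raise the value, and leaves an event of the past.\<close>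
    have "(\<integral>\<^sup>+\<omega>. Z (Suc n) \<omega> \<partial>M) \<le> (\<integral>\<^sup>+\<omega>. (if g n \<omega> then U (Suc n) (W (Suc n) \<omega>) else \<epsilon>) \<partial>M)"
      by (intro nn_integral_mono)
         (use step in \<open>auto simp: Z_def g_def not_less atLeastAtMostSuc_conv simp del: drive.simps\<close>)
    also have "\<dots> = (\<integral>\<^sup>+\<omega>'. (if g n \<omega>' then \<integral>\<^sup>+\<omega>. U (Suc n) (F n (W n \<omega>') (Y n \<omega>)) \<partial>M else \<epsilon>) \<partial>M)"
    proof (rule nn_integral_state_step)
      let ?G = "\<lambda>p. \<forall>i\<in>{m..n}. U i (drive F w0 p i) < \<epsilon>"
      show "g n \<omega> = ?G (restrict (\<lambda>i. Y i \<omega>) {..<n})" for \<omega>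
        by (simp add: g_def drive_restrict)
      show "Measurable.pred (PiM {..<n} (\<lambda>_. N)) ?G"
      proof (rule pred_intros_finite)
        fix i assume "i \<in> {m..n}"
        then have "(\<lambda>p. drive F w0 p i) \<in> measurable (PiM {..<n} (\<lambda>_. N)) S"
          by (intro measurable_drive F w0) simp
        from measurable_comp[OF this U]
        have [measurable]: "(\<lambda>p. U i (drive F w0 p i)) \<in> borel_measurable (PiM {..<n} (\<lambda>_. N))"
          by (simp add: o_def)
        show "Measurable.pred (PiM {..<n} (\<lambda>_. N)) (\<lambda>p. U i (drive F w0 p i) < \<epsilon>)"
          by measurable
      qed simp
    qed (rule U)
    also have "\<dots> \<le> (\<integral>\<^sup>+\<omega>. Z n \<omega> \<partial>M)"
      by (intro nn_integral_mono)
         (auto simp: Z_def intro!: drift measurable_space[OF measurable_state])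
    finally show ?case using step by simp
  qed
  define B where "B n = {\<omega>\<in>space M. \<exists>i\<in>{m..n}. \<epsilon> \<le> U i (W i \<omega>)}" for n
  have B[measurable]: "B n \<in> sets M" for n unfolding B_def by measurable
  have "\<epsilon> * emeasure M (B n) \<le> (\<integral>\<^sup>+\<omega>. U m (W m \<omega>) \<partial>M)" for n
  proof (cases "m \<le> n")
    case True
    have "\<epsilon> * emeasure M (B n) = (\<integral>\<^sup>+\<omega>. \<epsilon> * indicator (B n) \<omega> \<partial>M)"
      by (simp add: nn_integral_cmult_indicator)
    also have "\<dots> \<le> (\<integral>\<^sup>+\<omega>. Z n \<omega> \<partial>M)"
      by (intro nn_integral_mono) (auto simp: B_def Z_def g_def not_less indicator_def leD)
    finally show ?thesis using Z[OF True] by simp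
  next
    case False then show ?thesis by (simp add: B_def)
  qed
  then have "(SUP n. \<epsilon> * emeasure M (B n)) \<le> (\<integral>\<^sup>+\<omega>. U m (W m \<omega>) \<partial>M)"
    by (rule SUP_least)
  also have "(SUP n. \<epsilon> * emeasure M (B n)) = \<epsilon> * emeasure M (\<Union>n. B n)"
  proof -
    have "incseq B" by (auto simp: B_def incseq_def)
    then have "(SUP n. emeasure M (B n)) = emeasure M (\<Union>n. B n)"
      using B by (intro SUP_emeasure_incseq) auto
    then show ?thesis by (simp add: SUP_mult_left_ennreal[symmetric])
  qed
  also have "(\<Union>n. B n) = {\<omega>\<in>space M. \<exists>i\<ge>m. \<epsilon> \<le> U i (W i \<omega>)}"
    by (force simp: B_def)
  finally show ?thesis by simp
qed

text \<open>For each level \<open>\<epsilon>\<close>, reaching it infinitely often implies reaching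
  it after every \<open>m\<close>; the maximal inequality bounds the probability by the mean at
  \<open>m\<close> over \<open>\<epsilon>\<close>, which vanishes as \<open>m\<close> grows.\<close>

lemma supermartingale_tendsto_0:
  fixes U :: "nat \<Rightarrow> 'w \<Rightarrow> ennreal"
  assumes U: "\<And>k. U k \<in> borel_measurable S"
    and drift: "\<And>k w. w \<in> space S \<Longrightarrow> (\<integral>\<^sup>+\<omega>. U (Suc k) (F k w (Y k \<omega>)) \<partial>M) \<le> U k w"
    and lim: "(\<lambda>m. \<integral>\<^sup>+\<omega>. U m (W m \<omega>) \<partial>M) \<longlonglongrightarrow> 0"
  shows "AE \<omega> in M. (\<lambda>k. U k (W k \<omega>)) \<longlonglongrightarrow> 0"
proof -
  have UW[measurable]: "(\<lambda>\<omega>. U i (W i \<omega>)) \<in> borel_measurable M" for i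
    using measurable_comp[OF measurable_state U] by (simp add: o_def)
  have "AE \<omega> in M. \<exists>m. \<forall>i\<ge>m. U i (W i \<omega>) < \<epsilon>" if e: "0 < \<epsilon>" "\<epsilon> < \<infinity>" for \<epsilon> :: ennreal
  proof -
    define N where "N = {\<omega>\<in>space M. \<forall>m. \<exists>i\<ge>m. \<epsilon> \<le> U i (W i \<omega>)}"
    have N[measurable]: "N \<in> sets M" unfolding N_def by measurable
    have "\<epsilon> * emeasure M N \<le> (\<integral>\<^sup>+\<omega>. U m (W m \<omega>) \<partial>M)" for m
    proof -
      have "\<epsilon> * emeasure M N \<le> \<epsilon> * emeasure M {\<omega>\<in>space M. \<exists>i\<ge>m. \<epsilon> \<le> U i (W i \<omega>)}"
        by (intro mult_left_mono emeasure_mono) (auto simp: N_def)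
      also note supermartingale_maximal[OF U drift]
      finally show ?thesis .
    qed
    then have "\<epsilon> * emeasure M N \<le> 0"
      using lim by (intro LIMSEQ_le_const[OF lim]) auto
    then have "emeasure M N = 0" using e by auto
    then have "N \<in> null_sets M" by auto
    then have "AE \<omega> in M. \<omega> \<notin> N" by (rule AE_not_in)
    with AE_space show ?thesis
      by eventually_elim (auto simp: N_def, meson not_le)
  qed
  then have "AE \<omega> in M. \<exists>m. \<forall>i\<ge>m. U i (W i \<omega>) < ennreal (1 / Suc j)" for j
    by (simp add: ennreal_less_top)
  then have "AE \<omega> in M. \<forall>j. \<exists>m. \<forall>i\<ge>m. U i (W i \<omega>) < ennreal (1 / Suc j)"
    by (simp add: AE_all_countable)
  then show ?thesis
  proof eventually_elim
    case (elim \<omega>)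
    show ?case
    proof (rule order_tendstoI)
      fix e :: ennreal assume "0 < e"
      then obtain j where "ennreal (1 / Suc j) < e"
      proof (cases e)
        case (real r)
        then have "0 < r" using \<open>0 < e\<close> by simp
        then obtain j where "1 / Suc j < r" using nat_approx_posE by blast
        then show ?thesis using that[of j] real by (simp add: ennreal_lessI \<open>0 < r\<close>)
      next
        case top then show ?thesis using that[of 0] by (simp add: ennreal_less_top)
      qed
      then show "\<forall>\<^sub>F k in sequentially. U k (W k \<omega>) < e"
      proof -
        obtain m where "\<And>i. m \<le> i \<Longrightarrow> U i (W i \<omega>) < ennreal (1 / Suc j)" using elim by blast
        then show ?thesis
          using \<open>ennreal (1 / Suc j) < e\<close> unfolding eventually_sequentially
          by (intro exI[of _ m]) (auto intro: less_trans)
      qed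
    qed simp
  qed
qed

text \<open>The drift bound is used twice: integrated, it gives the real recursion that sends the
  means of \<open>V\<close> to 0; pointwise in \<open>w\<close>, it makes the discounted
  \<open>U\<close> a supermartingale. The condition \<open>a k \<le> 1 + b k\<close> keeps the
  factor of \<open>V w\<close> nonnegative, so that it passes through
  \<open>ennreal\<close>.\<close>

theorem lyapunov_tendsto_0:
  fixes V :: "'w \<Rightarrow> real" and a b :: "nat \<Rightarrow> real"
  assumes V: "V \<in> borel_measurable S" "\<And>w. 0 \<le> V w"
    and a: "\<And>k. 0 \<le> a k" "\<not> summable a" "\<And>k. a k \<le> 1 + b k"
    and b: "\<And>k. 0 \<le> b k" "summable b"
    and drift: "\<And>k w. w \<in> space S \<Longrightarrow>
      (\<integral>\<^sup>+\<omega>. ennreal (V (F k w (Y k \<omega>))) \<partial>M) \<le> ennreal ((1 - a k + b k) * V w + b k)"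
  shows "AE \<omega> in M. (\<lambda>k. V (W k \<omega>)) \<longlonglongrightarrow> 0"
proof -
  define v where "v k = (\<integral>\<^sup>+\<omega>. ennreal (V (W k \<omega>)) \<partial>M)" for k
  note V(1)[measurable]
  have W[measurable]: "(\<lambda>\<omega>. W k \<omega>) \<in> measurable M S" for k by (rule measurable_state)
  have r: "0 \<le> 1 - a k + b k" for k using a(3)[of k] by simp
  have vS: "v (Suc k) \<le> ennreal (1 - a k + b k) * v k + ennreal (b k)" for k
  proof -
    have "v (Suc k) = (\<integral>\<^sup>+\<omega>'. \<integral>\<^sup>+\<omega>. ennreal (V (F k (W k \<omega>') (Y k \<omega>))) \<partial>M \<partial>M)"
      using nn_integral_state_step[where g="\<lambda>_. True" and G="\<lambda>_. True" and U="\<lambda>w. ennreal (V w)" and k=k and c=0]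
      by (simp add: v_def)
    also have "\<dots> \<le> (\<integral>\<^sup>+\<omega>. ennreal ((1 - a k + b k) * V (W k \<omega>) + b k) \<partial>M)"
      by (intro nn_integral_mono drift measurable_space[OF W])
    also have "\<dots> = (\<integral>\<^sup>+\<omega>. ennreal (1 - a k + b k) * ennreal (V (W k \<omega>)) + ennreal (b k) \<partial>M)"
      using r b(1) V(2) by (intro nn_integral_cong) (simp add: ennreal_plus ennreal_mult)
    also have "\<dots> = ennreal (1 - a k + b k) * v k + ennreal (b k)"
      unfolding v_def by (subst nn_integral_add) (auto simp: nn_integral_cmult emeasure_space_1)
    finally show ?thesis .
  qed
  \<comment> \<open>The start is deterministic and the drift bound is affine, so finiteness
    propagates and the recursion may be read in the reals.\<close>
  have vfin: "v k < \<infinity>" for k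
  proof (induction k)
    case 0 then show ?case by (simp add: v_def emeasure_space_1)
  next
    case (Suc k)
    then have "ennreal (1 - a k + b k) * v k + ennreal (b k) < \<infinity>"
      by (simp add: ennreal_mult_less_top)
    then show ?case using vS[of k] by (rule le_less_trans[rotated])
  qed
  define vr where "vr k = enn2real (v k)" for k
  have vr: "v k = ennreal (vr k)" "0 \<le> vr k" for k using vfin[of k] by (simp_all add: vr_def)
  have "vr (Suc k) \<le> (1 - a k + b k) * vr k + b k" for k
    using vS[of k] r[of k] vr(2)[of k] vr(2)[of "Suc k"] b(1)[of k]
    by (simp add: vr(1) ennreal_mult[symmetric] ennreal_plus[symmetric] del: ennreal_plus)
  then have lim: "vr \<longlonglongrightarrow> 0"
    using perturbed_contraction_tendsto_0[OF b a(1,2)] vr(2) by blast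
  define p where "p = discount b"
  define \<tau> where "\<tau> = tail_sum b"
  define U where "U k w = ennreal (V w / p k + \<tau> k)" for k w
  have p: "1 \<le> p k" "0 < p k" "p k \<le> exp (suminf b)" for k
    using discount_ge_1[OF b, of k] discount_le[OF b, of k] by (auto simp: p_def)
  have \<tau>: "0 \<le> \<tau> k" for k using tail_sum_nonneg[OF b] by (simp add: \<tau>_def)
  have int_U: "(\<integral>\<^sup>+\<omega>. ennreal (f \<omega> / p k + \<tau> k) \<partial>M) = ennreal (1 / p k) * (\<integral>\<^sup>+\<omega>. ennreal (f \<omega>) \<partial>M) + ennreal (\<tau> k)"
    if f: "(\<lambda>\<omega>. f \<omega>) \<in> borel_measurable M" "\<And>\<omega>. 0 \<le> f \<omega>" for f k
  proof -
    have "(\<integral>\<^sup>+\<omega>. ennreal (f \<omega> / p k + \<tau> k) \<partial>M)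
        = (\<integral>\<^sup>+\<omega>. ennreal (1 / p k) * ennreal (f \<omega>) + ennreal (\<tau> k) \<partial>M)"
      using p(2)[of k] \<tau>[of k] f(2)
      by (intro nn_integral_cong) (simp add: ennreal_plus[symmetric] ennreal_mult[symmetric] less_imp_le
          del: ennreal_plus)
    then show ?thesis
      using f(1) by (simp add: nn_integral_add nn_integral_cmult emeasure_space_1)
  qed
  have "AE \<omega> in M. (\<lambda>k. U k (W k \<omega>)) \<longlonglongrightarrow> 0"
  proof (rule supermartingale_tendsto_0)
    show "U k \<in> borel_measurable S" for k unfolding U_def by measurable
  next
    fix k w assume w: "w \<in> space S"
    have "(\<lambda>\<omega>. (w, Y k \<omega>)) \<in> measurable M (S \<Otimes>\<^sub>M N)"
      by (rule measurable_compose[OF measurable_input measurable_Pair1'[OF w]])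
    from measurable_comp[OF measurable_comp[OF this F[of k]] V(1)]
    have m: "(\<lambda>\<omega>. V (F k w (Y k \<omega>))) \<in> borel_measurable M" by (simp add: o_def)
    have "(\<integral>\<^sup>+\<omega>. U (Suc k) (F k w (Y k \<omega>)) \<partial>M)
        = ennreal (1 / p (Suc k)) * (\<integral>\<^sup>+\<omega>. ennreal (V (F k w (Y k \<omega>))) \<partial>M) + ennreal (\<tau> (Suc k))"
      unfolding U_def by (rule int_U[OF m V(2)])
    also have "\<dots> \<le> ennreal (1 / p (Suc k)) * ennreal ((1 - a k + b k) * V w + b k) + ennreal (\<tau> (Suc k))"
      by (intro add_right_mono mult_left_mono drift w) auto
    also have "\<dots> = ennreal (((1 - a k + b k) * V w + b k) / p (Suc k) + \<tau> (Suc k))"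
      using p(2)[of "Suc k"] \<tau>[of "Suc k"] r[of k] V(2)[of w] b(1)[of k]
      by (simp add: ennreal_plus[symmetric] ennreal_mult[symmetric] less_imp_le del: ennreal_plus)
    also have "\<dots> \<le> U k w"
      unfolding U_def
    proof (rule ennreal_leI)
      have "0 \<le> a k * V w / p (Suc k)" using a(1) V(2) p(2) by (simp add: less_imp_le)
      then show "((1 - a k + b k) * V w + b k) / p (Suc k) + \<tau> (Suc k) \<le> V w / p k + \<tau> k"
        using discounted_drift[OF b V(2)[of w], of "a k" k] unfolding p_def \<tau>_def by linarith
    qed
    finally show "(\<integral>\<^sup>+\<omega>. U (Suc k) (F k w (Y k \<omega>)) \<partial>M) \<le> U k w" .
  next
    have "(\<lambda>k. ennreal (vr k + \<tau> k)) \<longlonglongrightarrow> ennreal (0 + 0)"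
      using tail_sum_tendsto[OF b] by (intro tendsto_intros lim) (simp add: \<tau>_def)
    then have lim': "(\<lambda>k. ennreal (vr k + \<tau> k)) \<longlonglongrightarrow> 0" by simp
    have le: "(\<integral>\<^sup>+\<omega>. U k (W k \<omega>) \<partial>M) \<le> ennreal (vr k + \<tau> k)" for k
    proof -
      have "(\<integral>\<^sup>+\<omega>. U k (W k \<omega>) \<partial>M) = ennreal (1 / p k) * v k + ennreal (\<tau> k)"
        unfolding U_def v_def by (rule int_U) (auto simp: V)
      also have "\<dots> = ennreal (vr k / p k + \<tau> k)"
        using p(2)[of k] \<tau>[of k] vr(2)[of k]
        by (simp add: vr(1) ennreal_plus[symmetric] ennreal_mult[symmetric] less_imp_le del: ennreal_plus)
      also have "\<dots> \<le> ennreal (vr k + \<tau> k)"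
        using p[of k] mult_left_mono[OF p(1)[of k] vr(2)[of k]] by (intro ennreal_leI) (simp add: divide_le_eq)
      finally show ?thesis .
    qed
    show "(\<lambda>k. \<integral>\<^sup>+\<omega>. U k (W k \<omega>) \<partial>M) \<longlonglongrightarrow> 0"
      by (rule tendsto_sandwich[OF _ _ tendsto_const lim']) (simp_all only: le zero_le eventually_True)
  qed
  then show ?thesis
  proof eventually_elim
    case (elim \<omega>)
    have "(\<lambda>k. V (W k \<omega>) / p k + \<tau> k) \<longlonglongrightarrow> 0"
      using elim p(2) \<tau> V(2)
      by (subst tendsto_ennreal_iff[symmetric]) (auto simp: U_def less_imp_le add_nonneg_nonneg)
    then have lim': "(\<lambda>k. exp (suminf b) * (V (W k \<omega>) / p k + \<tau> k)) \<longlonglongrightarrow> exp (suminf b) * 0"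
      by (intro tendsto_intros)
    \<comment> \<open>Undoing the discount costs a factor bounded uniformly in
      \<open>k\<close>.\<close>
    have "V (W k \<omega>) \<le> exp (suminf b) * (V (W k \<omega>) / p k + \<tau> k)" for k
    proof -
      have "V (W k \<omega>) = p k * (V (W k \<omega>) / p k)" using p(2)[of k] by simp
      also have "\<dots> \<le> exp (suminf b) * (V (W k \<omega>) / p k + \<tau> k)"
        using p[of k] \<tau>[of k] V(2) by (intro mult_mono) (auto simp: less_imp_le)
      finally show ?thesis .
    qed
    then have le: "V (W k \<omega>) \<le> exp (suminf b) * (V (W k \<omega>) / p k + \<tau> k)" for k .
    from lim' have lim'': "(\<lambda>k. exp (suminf b) * (V (W k \<omega>) / p k + \<tau> k)) \<longlonglongrightarrow> 0" by simp
    show ?case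
      by (rule tendsto_sandwich[OF _ _ tendsto_const lim'']) (simp_all only: le V(2) eventually_True)
  qed
qed

end

end

section \<open>Occupancy and survival of a proper chain\<close>

definition state_pmf :: "'n pmf \<Rightarrow> ('n \<Rightarrow> 'n option pmf) \<Rightarrow> nat \<Rightarrow> 'n option pmf" where
  "state_pmf \<zeta>0 K t = map_pmf (\<lambda>xs. xs ! t) (init_path_pmf \<zeta>0 K t)"

text \<open>\<open>path_pmf\<close> unfolds at its first step, whereas the laws of
  \<open>x_t\<close> evolve at the last one; this exchanges the two ends.\<close>

lemma path_pmf_last_step:
  "map_pmf (\<lambda>xs. (xs ! t, xs ! Suc t)) (path_pmf K (Suc t) s)
    = bind_pmf (map_pmf (\<lambda>xs. xs ! t) (path_pmf K t s)) (\<lambda>a. map_pmf (Pair a) (step K a))"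
proof (induction t arbitrary: s)
  case 0
  then show ?case by (simp add: map_bind_pmf bind_return_pmf map_pmf_def bind_assoc_pmf)
next
  case (Suc t)
  show ?case
    apply (subst path_pmf.simps(2))
    apply (subst (2) path_pmf.simps(2))
    using Suc by (simp add: map_bind_pmf pmf.map_comp o_def bind_assoc_pmf del: path_pmf.simps(2))
qed

text \<open>The terminal state is absorbing under \<open>step\<close>. This turns the visit to
  \<open>None\<close> in the definition of \<open>proper\<close> into an event of the last state
  alone.\<close>

lemma path_pmf_None_last:
  assumes "xs \<in> set_pmf (path_pmf K t s)" "None \<in> set xs"
  shows "xs ! t = None"
proof -
  \<comment> \<open>The head is carried through the induction: when \<open>s = None\<close> the tail
    starts at \<open>None\<close> again, and only its head shows this.\<close>
  have "xs \<in> set_pmf (path_pmf K t s) \<Longrightarrow> hd xs = s \<and> xs \<noteq> [] \<and> (None \<in> set xs \<longrightarrow> xs ! t = None)"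
  proof (induction t arbitrary: s xs)
    case (Suc t)
    then obtain s' ys where "s' \<in> set_pmf (step K s)" "ys \<in> set_pmf (path_pmf K t s')"
      and xs: "xs = s # ys" by auto
    moreover from this Suc.IH[of ys s'] have "hd ys = s'" "ys \<noteq> []" "None \<in> set ys \<longrightarrow> ys ! t = None"
      by auto
    moreover have "hd ys \<in> set ys" using \<open>ys \<noteq> []\<close> by simp
    ultimately show ?case by (auto simp: step_def)
  qed auto
  then show ?thesis using assms by auto
qed

lemma init_path_pmf_last_step:
  "map_pmf (\<lambda>xs. (xs ! t, xs ! Suc t)) (init_path_pmf \<zeta>0 K (Suc t))
    = bind_pmf (state_pmf \<zeta>0 K t) (\<lambda>a. map_pmf (Pair a) (step K a))"
  unfolding init_path_pmf_def state_pmf_def map_bind_pmf path_pmf_last_step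
  by (simp add: bind_assoc_pmf)

lemma state_pmf_0: "state_pmf \<zeta>0 K 0 = map_pmf Some \<zeta>0"
  by (simp add: state_pmf_def init_path_pmf_def map_bind_pmf map_pmf_def bind_assoc_pmf bind_return_pmf)

lemma state_pmf_Suc: "state_pmf \<zeta>0 K (Suc t) = bind_pmf (state_pmf \<zeta>0 K t) (step K)"
proof -
  have "state_pmf \<zeta>0 K (Suc t)
      = map_pmf snd (map_pmf (\<lambda>xs. (xs ! t, xs ! Suc t)) (init_path_pmf \<zeta>0 K (Suc t)))"
    by (simp add: state_pmf_def pmf.map_comp o_def)
  then show ?thesis
    by (simp add: init_path_pmf_last_step map_bind_pmf pmf.map_comp o_def)
qed

text \<open>The Markov property at time \<open>t\<close>, needed to restart the chain and apply
  properness from whatever state it then occupies.\<close>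

lemma state_pmf_add:
  "state_pmf \<zeta>0 K (t + m)
    = bind_pmf (state_pmf \<zeta>0 K t) (\<lambda>a. map_pmf (\<lambda>xs. xs ! m) (path_pmf K m a))"
proof (induction m)
  case (Suc m)
  have "map_pmf (\<lambda>xs. xs ! Suc m) (path_pmf K (Suc m) a)
      = map_pmf snd (map_pmf (\<lambda>xs. (xs ! m, xs ! Suc m)) (path_pmf K (Suc m) a))" for a
    by (simp only: pmf.map_comp o_def snd_conv)
  then have *: "map_pmf (\<lambda>xs. xs ! Suc m) (path_pmf K (Suc m) a)
      = bind_pmf (map_pmf (\<lambda>xs. xs ! m) (path_pmf K m a)) (step K)" for a
    by (simp only: path_pmf_last_step map_bind_pmf pmf.map_comp o_def snd_conv) simp
  have "state_pmf \<zeta>0 K (t + Suc m) = bind_pmf (state_pmf \<zeta>0 K (t + m)) (step K)"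
    by (simp add: state_pmf_Suc)
  then show ?case
    by (simp only: Suc * bind_assoc_pmf)
qed (simp add: bind_return_pmf')

lemma pmf_bind_Pair:
  fixes p :: "'a::finite pmf"
  shows "pmf (bind_pmf p (\<lambda>a. map_pmf (Pair a) (k a))) (a, b) = pmf p a * pmf (k a) b"
proof -
  have *: "pmf (map_pmf (Pair c) (k c)) (a, b) = (if c = a then pmf (k a) b else 0)" for c
    by (auto simp: pmf_map_inj' inj_on_def intro!: pmf_map_outside)
  have "pmf (bind_pmf p (\<lambda>a. map_pmf (Pair a) (k a))) (a, b)
      = (\<Sum>c\<in>UNIV. pmf (map_pmf (Pair c) (k c)) (a, b) * pmf p c)"
    by (simp add: pmf_bind integral_measure_pmf_real[where A=UNIV])
  also have "\<dots> = (\<Sum>c\<in>UNIV. if c = a then pmf (k a) b * pmf p a else 0)"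
    by (intro sum.cong) (auto simp: *)
  finally show ?thesis by simp
qed

lemma occ_at_state: "occ_at \<zeta>0 K t x = pmf (state_pmf \<zeta>0 K t) (Some x)"
  by (simp add: occ_at_def state_pmf_def pmf_map vimage_def)

lemma UNIV_option_sum: "(\<Sum>a\<in>UNIV. f a) = f None + (\<Sum>x\<in>UNIV. f (Some x))"
  for f :: "'n::finite option \<Rightarrow> 'b::comm_monoid_add"
  by (simp add: UNIV_option_conv sum.reindex)

lemma occ_at_0: "occ_at \<zeta>0 K 0 x = pmf \<zeta>0 x"
  by (simp add: occ_at_state state_pmf_0 pmf_map_inj')

lemma occ_at_Suc:
  fixes \<zeta>0 :: "'n::finite pmf"
  shows "occ_at \<zeta>0 K (Suc t) y = (\<Sum>x\<in>UNIV. occ_at \<zeta>0 K t x * pmf (K x) (Some y))"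
  by (simp add: occ_at_state state_pmf_Suc pmf_bind integral_measure_pmf_real[where A=UNIV]
      UNIV_option_sum step_def mult.commute)

section \<open>Geometric decay of the survival probabilities\<close>

text \<open>The probability that \<open>x_t\<close> is not terminal, that is, the probability of
  \<open>\<tau> > t\<close>.\<close>

definition alive :: "'n pmf \<Rightarrow> ('n::finite \<Rightarrow> 'n option pmf) \<Rightarrow> nat \<Rightarrow> real" where
  "alive \<zeta>0 K t = (\<Sum>x\<in>UNIV. occ_at \<zeta>0 K t x)"

lemma alive_nonneg: "0 \<le> alive \<zeta>0 K t"
  by (simp add: alive_def occ_at_def sum_nonneg)

lemma alive_le_1: "alive \<zeta>0 K t \<le> 1"
proof -
  have "(\<Sum>a\<in>UNIV. pmf (state_pmf \<zeta>0 K t) a) = 1" by (rule sum_pmf_eq_1) auto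
  then show ?thesis
    using pmf_nonneg[of "state_pmf \<zeta>0 K t" None]
    by (simp add: UNIV_option_sum alive_def occ_at_state del: pmf_nonneg)
qed

lemma occ_at_nonneg: "0 \<le> occ_at \<zeta>0 K t x"
  by (simp add: occ_at_def)

lemma occ_at_le_alive: "occ_at \<zeta>0 K t x \<le> alive \<zeta>0 K t"
  unfolding alive_def by (rule member_le_sum) (auto simp: occ_at_nonneg)

text \<open>Properness gives each of the finitely many states a positive probability of absorption
  within \<open>n\<close> steps; the smallest of them is lost by the surviving mass in every block
  of \<open>n\<close> steps.\<close>

lemma alive_contracts:
  fixes K :: "'n::finite \<Rightarrow> 'n option pmf"
  assumes "proper K"
  obtains \<rho> where "0 < \<rho>" "\<rho> < 1"
    "\<And>\<zeta>0 t. alive \<zeta>0 K (t + CARD('n)) \<le> \<rho> * alive \<zeta>0 K t"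
proof -
  let ?n = "CARD('n)"
  define d where "d x = map_pmf (\<lambda>xs. xs ! ?n) (path_pmf K ?n (Some x))" for x
  have pos: "pmf (d x) None > 0" for x
  proof -
    have "0 < measure_pmf.prob (path_pmf K ?n (Some x)) {xs. None \<in> set xs}"
      using assms by (simp add: proper_def)
    also have "\<dots> \<le> measure_pmf.prob (path_pmf K ?n (Some x)) {xs. xs ! ?n = None}"
      by (rule measure_pmf.finite_measure_mono_AE)
         (auto simp: AE_measure_pmf_iff dest: path_pmf_None_last)
    finally show ?thesis by (simp add: d_def pmf_map vimage_def)
  qed
  \<comment> \<open>The cap at 1/2 keeps \<open>\<rho> = 1 - \<epsilon>\<close> positive, so that
    roots of \<open>\<rho>\<close> and division by it make sense later.\<close>
  define \<epsilon> where "\<epsilon> = min (1/2) (Min (range (\<lambda>x. pmf (d x) None)))"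
  have \<epsilon>: "0 < \<epsilon>" "\<epsilon> \<le> 1/2" "\<epsilon> \<le> pmf (d x) None" for x
    using pos by (auto simp: \<epsilon>_def min.coboundedI2)
  have surv: "(\<Sum>y\<in>UNIV. pmf (d x) (Some y)) \<le> 1 - \<epsilon>" for x
  proof -
    have "(\<Sum>a\<in>UNIV. pmf (d x) a) = 1" by (rule sum_pmf_eq_1) auto
    then show ?thesis using \<epsilon>(3)[of x] by (simp add: UNIV_option_sum)
  qed
  have dead: "pmf (map_pmf (\<lambda>xs. xs ! ?n) (path_pmf K ?n None)) (Some y) = 0" for y
  proof -
    have "hd xs = None" if "xs \<in> set_pmf (path_pmf K m None)" for xs m
      using that by (cases m) auto
    moreover have "xs \<noteq> []" if "xs \<in> set_pmf (path_pmf K m None)" for xs m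
      using that by (cases m) auto
    ultimately have "None \<in> set xs" if "xs \<in> set_pmf (path_pmf K m None)" for xs m
      using that by (metis hd_in_set)
    then have "xs ! ?n = None" if "xs \<in> set_pmf (path_pmf K ?n None)" for xs
      using that path_pmf_None_last by blast
    then show ?thesis by (force simp: pmf_eq_0_set_pmf)
  qed
  have "alive \<zeta>0 K (t + ?n) \<le> (1 - \<epsilon>) * alive \<zeta>0 K t" for \<zeta>0 t
  proof -
    have "alive \<zeta>0 K (t + ?n) = (\<Sum>y\<in>UNIV. \<Sum>x\<in>UNIV. occ_at \<zeta>0 K t x * pmf (d x) (Some y))"
      unfolding alive_def
      by (intro sum.cong refl, subst occ_at_state, subst state_pmf_add)
         (simp add: pmf_bind integral_measure_pmf_real[where A=UNIV] UNIV_option_sum dead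
           d_def[symmetric] occ_at_state mult.commute)
    also have "\<dots> = (\<Sum>x\<in>UNIV. occ_at \<zeta>0 K t x * (\<Sum>y\<in>UNIV. pmf (d x) (Some y)))"
      by (subst sum.swap) (simp add: sum_distrib_left)
    also have "\<dots> \<le> (\<Sum>x\<in>UNIV. occ_at \<zeta>0 K t x * (1 - \<epsilon>))"
      by (intro sum_mono mult_left_mono surv occ_at_nonneg)
    finally show ?thesis by (simp add: alive_def sum_distrib_left mult.commute)
  qed
  then show ?thesis using \<epsilon>(1,2) by (intro that[of "1 - \<epsilon>"]) auto
qed

lemma alive_geometric:
  fixes K :: "'n::finite \<Rightarrow> 'n option pmf"
  assumes "proper K"
  obtains C \<beta> where "0 < \<beta>" "\<beta> < 1" "\<And>\<zeta>0 t. alive \<zeta>0 K t \<le> C * \<beta> ^ t"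
proof -
  let ?n = "CARD('n)"
  obtain \<rho> where \<rho>: "0 < \<rho>" "\<rho> < 1" "\<And>\<zeta>0 t. alive \<zeta>0 K (t + ?n) \<le> \<rho> * alive \<zeta>0 K t"
    using alive_contracts[OF assms] by metis
  define \<beta> where "\<beta> = root ?n \<rho>"
  have n: "?n > 0" by simp
  have \<beta>: "0 < \<beta>" "\<beta> < 1" "\<beta> ^ ?n = \<rho>"
    using \<rho> n by (auto simp: \<beta>_def real_root_pow_pos)
  \<comment> \<open>The constant \<open>1 / \<rho>\<close> covers the first block: for
    \<open>t\<close> below \<open>n\<close> the power \<open>\<beta> ^ t\<close> is at least
    \<open>\<beta> ^ n = \<rho>\<close>, and \<open>alive\<close> is at most 1.\<close>
  have "alive \<zeta>0 K t \<le> 1 / \<rho> * \<beta> ^ t" for \<zeta>0 t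
  proof (induction t rule: less_induct)
    case (less t)
    show ?case
    proof (cases "t < ?n")
      case True
      then have "\<beta> ^ ?n \<le> \<beta> ^ t" using \<beta> by (intro power_decreasing) auto
      then have "1 \<le> 1 / \<rho> * \<beta> ^ t" using \<rho> \<beta> by (simp add: field_simps)
      then show ?thesis using alive_le_1[of \<zeta>0 K t] by linarith
    next
      case False
      then have t: "t = (t - ?n) + ?n" "t - ?n < t" using n False by linarith+
      have "alive \<zeta>0 K t \<le> \<rho> * alive \<zeta>0 K (t - ?n)" using \<rho>(3)[of \<zeta>0 "t - ?n"] t(1) by simp
      also have "\<dots> \<le> \<rho> * (1 / \<rho> * \<beta> ^ (t - ?n))"
        using less[OF t(2)] \<rho> by (intro mult_left_mono) auto
      also have "\<dots> = 1 / \<rho> * \<beta> ^ t"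
        by (subst (2) t(1)) (use \<rho> in \<open>simp only: power_add \<beta>, simp\<close>)
      finally show ?thesis .
    qed
  qed
  then show ?thesis using that \<beta> by metis
qed

text \<open>The weights are the increments of the squares, so the series is the second moment of
  \<open>\<tau>\<close>. It is dominated by the derivative of a geometric series.\<close>

lemma alive_moment_summable:
  assumes "proper K"
  shows "summable (\<lambda>t. (2 * real t + 1) * alive \<zeta>0 K t)"
proof -
  obtain C \<beta> where b: "0 < \<beta>" "\<beta> < 1" "\<And>\<zeta>0 t. alive \<zeta>0 K t \<le> C * \<beta> ^ t"
    using alive_geometric[OF assms] by metis
  have "summable (\<lambda>t. (2 * C) * (of_nat (Suc t) * \<beta> ^ t))"
    using geometric_deriv_sums[of \<beta>] b by (intro summable_mult) (auto simp: sums_iff)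
  then show ?thesis
  proof (rule summable_comparison_test')
    fix t :: nat
    have "(2 * real t + 1) * alive \<zeta>0 K t \<le> (2 * real t + 2) * (C * \<beta> ^ t)"
      using b(3)[of \<zeta>0 t] alive_nonneg[of \<zeta>0 K t] by (intro mult_mono) auto
    then show "norm ((2 * real t + 1) * alive \<zeta>0 K t) \<le> (2 * C) * (of_nat (Suc t) * \<beta> ^ t)"
      using alive_nonneg[of \<zeta>0 K t] by (simp add: algebra_simps)
  qed
qed

lemma alive_summable:
  assumes "proper K"
  shows "summable (alive \<zeta>0 K)"
  by (rule summable_comparison_test'[OF alive_moment_summable[OF assms, of \<zeta>0]])
     (simp add: alive_nonneg mult_right_mono algebra_simps)

lemma occ_at_summable:
  assumes "proper K"
  shows "summable (\<lambda>t. occ_at \<zeta>0 K t x)"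
  by (rule summable_comparison_test'[OF alive_summable[OF assms, of \<zeta>0]])
     (simp add: occ_at_nonneg occ_at_le_alive)

lemma occ_balance:
  fixes \<zeta>0 :: "'n::finite pmf"
  assumes "proper K"
  shows "occ \<zeta>0 K y = pmf \<zeta>0 y + (\<Sum>x\<in>UNIV. occ \<zeta>0 K x * pmf (K x) (Some y))"
proof -
  note s = occ_at_summable[OF assms, of \<zeta>0]
  have "occ \<zeta>0 K y = occ_at \<zeta>0 K 0 y + (\<Sum>t. occ_at \<zeta>0 K (Suc t) y)"
    unfolding occ_def by (simp add: suminf_split_head[OF s])
  also have "(\<Sum>t. occ_at \<zeta>0 K (Suc t) y) = (\<Sum>x\<in>UNIV. occ \<zeta>0 K x * pmf (K x) (Some y))"
    unfolding occ_at_Suc occ_def using s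
    by (subst suminf_sum) (auto intro!: summable_mult2 sum.cong simp: suminf_mult2)
  finally show ?thesis by (simp add: occ_at_0)
qed

section \<open>Projected Bellman equations\<close>

lemma winner_add_left: "winner q (y + y') z = winner q y z + winner q y' z"
  by (simp add: winner_def algebra_simps sum.distrib)

lemma winner_diff_left: "winner q (y - y') z = winner q y z - winner q y' z"
  by (simp add: winner_def algebra_simps sum_subtractf)

lemma winner_diff_right: "winner q y (z - z') = winner q y z - winner q y z'"
  by (simp add: winner_def algebra_simps sum_subtractf)

lemma winner_scaleR_left: "winner q (c *\<^sub>R y) z = c * winner q y z"
  by (simp add: winner_def sum_distrib_left mult_ac)

lemma winner_scaleR_right: "winner q y (c *\<^sub>R z) = c * winner q y z"
  by (simp add: winner_def sum_distrib_left mult_ac)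

lemma winner_commute: "winner q y z = winner q z y"
  by (simp add: winner_def mult_ac)

lemma winner_self_nonneg: "(\<And>i. 0 < q i) \<Longrightarrow> 0 \<le> winner q y y"
  by (simp add: winner_def sum_nonneg mult.assoc less_imp_le)

lemma winner_self_eq_0_iff: "(\<And>i. 0 < q i) \<Longrightarrow> winner q y y = 0 \<longleftrightarrow> y = 0"
  unfolding winner_def
  by (subst sum_nonneg_eq_0_iff) (auto simp: mult.assoc less_imp_le vec_eq_iff less_imp_neq[symmetric])

text \<open>The vector \<open>A^T diag(q) y\<close>: the adjoint of \<open>A\<close> between the
  Euclidean inner product on weights and the \<open>q\<close>-weighted one on states.\<close>

definition wadj :: "('n::finite \<Rightarrow> real) \<Rightarrow> real^'l^'n \<Rightarrow> real^'n \<Rightarrow> real^'l" where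
  "wadj q A y = (\<chi> i. q i * y $ i) v* A"

lemma inner_wadj: "wadj q A y \<bullet> e = winner q y (A *v e)"
  by (simp add: wadj_def dot_lmul_matrix) (simp add: inner_vec_def winner_def)

lemma linear_wadj: "linear (wadj q A)"
proof (rule linearI)
  show "wadj q A (x + y) = wadj q A x + wadj q A y" for x y
    by (rule vector_eq_rdot[THEN iffD1]) (simp add: inner_wadj inner_add_left winner_add_left)
  show "wadj q A (c *\<^sub>R x) = c *\<^sub>R wadj q A x" for c x
    by (rule vector_eq_rdot[THEN iffD1]) (simp add: inner_wadj winner_scaleR_left)
qed

text \<open>A kernel vector \<open>e\<close> would give \<open>f e \<bullet> e = 0\<close>, so
  \<open>f\<close> is injective, hence onto in finite dimension. Symmetry is not assumed, which
  suits the Bellman operator.\<close>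

lemma linear_definite_ex1:
  fixes f :: "'a::euclidean_space \<Rightarrow> 'a"
  assumes f: "linear f" and def: "\<And>e. e \<noteq> 0 \<Longrightarrow> f e \<bullet> e \<noteq> 0"
  shows "\<exists>!w. f w = b"
proof -
  have "inj f" using def unfolding linear_injective_0[OF f] by force
  moreover from this f have "surj f" using linear_inj_imp_surj f by blast
  ultimately show ?thesis by (metis injD surjD)
qed

lemma inj_matrix_vector_mult_nonzero:
  fixes A :: "real^'l^'n"
  assumes "inj ((*v) A)" "e \<noteq> 0"
  shows "A *v e \<noteq> 0"
  using injD[OF assms(1), of e 0] assms(2) by auto

text \<open>\<open>wproj\<close> is a definite description, so existence and uniqueness come first:
  the normal equations \<open>A^T diag(q) A w = A^T diag(q) y\<close> provide a point, definiteness
  of the weighted product makes it unique.\<close>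

lemma wproj_eq_iff:
  fixes A :: "real^'l^'n"
  assumes q: "\<And>i. 0 < q i" and A: "inj ((*v) A)"
  shows "wproj q (range ((*v) A)) y = A *v w \<longleftrightarrow> (\<forall>e. winner q (y - A *v w) (A *v e) = 0)"
proof -
  let ?Q = "\<lambda>z. z \<in> range ((*v) A) \<and> (\<forall>s\<in>range ((*v) A). winner q (y - z) s = 0)"
  have "\<exists>!w. (wadj q A \<circ> (*v) A) w = wadj q A y"
    using q inj_matrix_vector_mult_nonzero[OF A]
    by (intro linear_definite_ex1 linear_compose linear_wadj)
      (simp_all add: inner_wadj winner_self_eq_0_iff)
  then obtain w' where w': "wadj q A (A *v w') = wadj q A y" by auto
  have o: "winner q (y - A *v w') (A *v e) = 0" for e
    using w' by (metis inner_wadj right_minus_eq winner_diff_left)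
  have uniq: "z = z'" if z: "?Q z" "?Q z'" for z z'
  proof -
    obtain u where u: "z = A *v u" using z(1) by auto
    obtain u' where u': "z' = A *v u'" using z(2) by auto
    have "z - z' = A *v (u - u')" by (simp add: u u' matrix_vector_mult_diff_distrib)
    then have "winner q (y - z) (z - z') = 0" "winner q (y - z') (z - z') = 0"
      using z by auto
    then have "winner q (z - z') (z - z') = 0"
      by (simp add: winner_diff_left)
    then show ?thesis using q by (simp add: winner_self_eq_0_iff)
  qed
  have Q: "?Q (A *v w')" using o by auto
  have ex1: "\<exists>!z. ?Q z"
  proof (rule ex1I)
    show "?Q (A *v w')" by (rule Q)
    show "z = A *v w'" if "?Q z" for z by (rule uniq[OF that Q])
  qed
  have "(THE z. ?Q z) = z \<longleftrightarrow> ?Q z" for z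
    using theI'[OF ex1] the1_equality[OF ex1, of z] by blast
  then have "wproj q (range ((*v) A)) y = A *v w \<longleftrightarrow> ?Q (A *v w)"
    unfolding wproj_def .
  then show ?thesis by auto
qed

text \<open>The constant is the minimum on the unit sphere, positive by compactness and carried to
  all vectors by homogeneity.\<close>

lemma homogeneous_coercive:
  fixes f :: "'a::euclidean_space \<Rightarrow> real"
  assumes cont: "continuous_on UNIV f" and hom: "\<And>t e. f (t *\<^sub>R e) = t\<^sup>2 * f e"
    and pos: "\<And>e. e \<noteq> 0 \<Longrightarrow> 0 < f e"
  obtains c where "0 < c" "\<And>e. c * (norm e)\<^sup>2 \<le> f e"
proof -
  have "sphere (0::'a) 1 \<noteq> {}" by simp
  then obtain m where m: "m \<in> sphere 0 1" "\<forall>e\<in>sphere 0 1. f m \<le> f e"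
    using continuous_attains_inf[OF compact_sphere _ continuous_on_subset[OF cont subset_UNIV]]
    by metis
  have "f m * (norm e)\<^sup>2 \<le> f e" for e
  proof (cases "e = 0")
    case True
    then show ?thesis using hom[of 0 0] by simp
  next
    case False
    then have "f m \<le> f ((1 / norm e) *\<^sub>R e)" by (intro m(2)[rule_format]) simp
    then show ?thesis using False by (simp add: hom field_simps)
  qed
  moreover have "0 < f m" using m(1) by (intro pos) auto
  ultimately show ?thesis by (rule that[rotated])
qed

section \<open>The transition operator in the occupancy norm\<close>

lemma trans_mat_vec: "(trans_mat K *v h) $ s = (\<Sum>y\<in>UNIV. pmf (K s) (Some y) * h $ y)"
  by (simp add: trans_mat_def matrix_vector_mult_def)

lemma sub_stochastic: "(\<Sum>y\<in>UNIV. pmf (K s) (Some y)) \<le> 1"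
  for K :: "'n::finite \<Rightarrow> 'n option pmf"
proof -
  have "(\<Sum>a\<in>UNIV. pmf (K s) a) = 1" by (rule sum_pmf_eq_1) auto
  then show ?thesis
    using pmf_nonneg[of "K s" None] by (simp add: UNIV_option_sum del: pmf_nonneg)
qed

text \<open>For the chain started at \<open>s\<close>, harmonicity makes \<open>h $ s\<close> the
  mean of \<open>h\<close> over the surviving states at every time \<open>t\<close>, and the
  occupation probabilities tend to 0.\<close>

lemma harmonic_eq_0:
  fixes K :: "'n::finite \<Rightarrow> 'n option pmf"
  assumes "proper K" and h: "trans_mat K *v h = h"
  shows "h = 0"
proof -
  have "h $ s = 0" for s
  proof -
    let ?o = "occ_at (return_pmf s) K"
    have eq: "h $ s = (\<Sum>x\<in>UNIV. ?o t x * h $ x)" for t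
    proof (induction t)
      case 0
      have "?o 0 x * h $ x = (if x = s then h $ s else 0)" for x
        by (simp add: occ_at_0 indicator_def)
      then show ?case by simp
    next
      case (Suc t)
      have "(\<Sum>y\<in>UNIV. ?o (Suc t) y * h $ y)
          = (\<Sum>y\<in>UNIV. \<Sum>x\<in>UNIV. ?o t x * (pmf (K x) (Some y) * h $ y))"
        by (simp add: occ_at_Suc sum_distrib_right mult.assoc)
      also have "\<dots> = (\<Sum>x\<in>UNIV. ?o t x * (trans_mat K *v h) $ x)"
        by (subst sum.swap) (simp add: trans_mat_vec sum_distrib_left)
      finally show ?case using Suc h by simp
    qed
    have "(\<lambda>t. \<Sum>x\<in>UNIV. ?o t x * h $ x) \<longlonglongrightarrow> (\<Sum>x\<in>(UNIV::'n set). 0 * h $ x)"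
      by (intro tendsto_intros summable_LIMSEQ_zero occ_at_summable assms)
    then show ?thesis using eq by (simp add: LIMSEQ_const_iff flip: eq)
  qed
  then show ?thesis by (simp add: vec_eq_iff)
qed

context
  fixes K :: "'n::finite \<Rightarrow> 'n option pmf" and \<zeta>0 :: "'n pmf"
  assumes proper: "proper K" and occ_pos: "\<And>s. 0 < occ \<zeta>0 K s"
begin

text \<open>Jensen for the substochastic rows, then exchange of the sums: the weight of
  \<open>(h $ y)\<^sup>2\<close> becomes \<open>(P^T q) y\<close>, which is \<open>q y\<close> minus
  the initial mass by \<open>occ_balance\<close>.\<close>

lemma trans_mat_contracts:
  "winner (occ \<zeta>0 K) (trans_mat K *v h) (trans_mat K *v h) \<le> winner (occ \<zeta>0 K) h h"
proof -
  let ?q = "occ \<zeta>0 K"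
  have "((trans_mat K *v h) $ x)\<^sup>2 \<le> (\<Sum>y\<in>UNIV. pmf (K x) (Some y) * (h $ y)\<^sup>2)" for x
  proof -
    \<comment> \<open>Cauchy-Schwarz after splitting each transition probability into two square
      roots.\<close>
    have "((trans_mat K *v h) $ x)\<^sup>2
        = (\<Sum>y\<in>UNIV. sqrt (pmf (K x) (Some y)) * (sqrt (pmf (K x) (Some y)) * h $ y))\<^sup>2"
      by (simp add: trans_mat_vec mult.assoc[symmetric])
    also have "\<dots> \<le> (\<Sum>y\<in>UNIV. pmf (K x) (Some y)) * (\<Sum>y\<in>UNIV. pmf (K x) (Some y) * (h $ y)\<^sup>2)"
      by (rule order_trans[OF Cauchy_Schwarz_ineq_sum]) (simp add: power_mult_distrib)
    also have "\<dots> \<le> 1 * (\<Sum>y\<in>UNIV. pmf (K x) (Some y) * (h $ y)\<^sup>2)"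
      by (intro mult_right_mono sub_stochastic sum_nonneg) auto
    finally show ?thesis by simp
  qed
  then have "winner ?q (trans_mat K *v h) (trans_mat K *v h)
      \<le> (\<Sum>x\<in>UNIV. ?q x * (\<Sum>y\<in>UNIV. pmf (K x) (Some y) * (h $ y)\<^sup>2))"
    unfolding winner_def using occ_pos
    by (auto intro!: sum_mono mult_left_mono simp: mult.assoc power2_eq_square[symmetric] less_imp_le)
  also have "\<dots> = (\<Sum>y\<in>UNIV. (\<Sum>x\<in>UNIV. ?q x * pmf (K x) (Some y)) * (h $ y)\<^sup>2)"
    by (simp add: sum_distrib_left sum_distrib_right mult.assoc) (rule sum.swap)
  also have "\<dots> \<le> (\<Sum>y\<in>UNIV. ?q y * (h $ y)\<^sup>2)"
  proof (intro sum_mono mult_right_mono)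
    show "(\<Sum>x\<in>UNIV. ?q x * pmf (K x) (Some y)) \<le> ?q y" for y
      using occ_balance[OF proper, of \<zeta>0 y] pmf_nonneg[of \<zeta>0 y] by linarith
  qed simp
  finally show ?thesis by (simp add: winner_def power2_eq_square mult.assoc)
qed

text \<open>\<open>trans_mat_contracts\<close> gives only a weak inequality; the strict sign comes
  from \<open>h - P h\<close>, which is nonzero because a nonzero \<open>h\<close> cannot be
  harmonic.\<close>

lemma bellman_positive:
  assumes "h \<noteq> 0"
  shows "0 < winner (occ \<zeta>0 K) (h - trans_mat K *v h) h"
proof -
  let ?q = "occ \<zeta>0 K" and ?d = "h - trans_mat K *v h"
  have "winner ?q ?d ?d \<noteq> 0"
    using harmonic_eq_0[OF proper, of h] assms occ_pos by (auto simp: winner_self_eq_0_iff)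
  then have "0 < winner ?q ?d ?d"
    using winner_self_nonneg[of ?q ?d, OF occ_pos] by linarith
  \<comment> \<open>Polarisation: \<open>2\<langle>h - P h, h\<rangle> = \<parallel>h\<parallel>\<^sup>2 - \<parallel>P h\<parallel>\<^sup>2 + \<parallel>h - P h\<parallel>\<^sup>2\<close>.\<close>
  then show ?thesis
    using trans_mat_contracts[of h]
    by (simp add: winner_diff_left winner_diff_right winner_commute[of _ "trans_mat K *v h" h])
qed

lemma bellman_coercive:
  fixes A :: "real^'l^'n"
  assumes A: "inj ((*v) A)"
  obtains c where "0 < c"
    "\<And>e. c * (norm e)\<^sup>2 \<le> winner (occ \<zeta>0 K) (A *v e - trans_mat K *v (A *v e)) (A *v e)"
proof (rule homogeneous_coercive)
  let ?f = "\<lambda>e. winner (occ \<zeta>0 K) (A *v e - trans_mat K *v (A *v e)) (A *v e)"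
  have c: "continuous_on UNIV (\<lambda>e. A *v e)" for A :: "real^'x^'y"
    by (rule linear_continuous_on) simp
  have "continuous_on UNIV (\<lambda>e. trans_mat K *v (A *v e))"
    using continuous_on_compose2[OF c c] by auto
  then show "continuous_on UNIV ?f"
    unfolding winner_def by (intro continuous_intros c)
  show "?f (t *\<^sub>R e) = t\<^sup>2 * ?f e" for t e
    by (simp add: matrix_vector_mult_scaleR winner_scaleR_right winner_scaleR_left power2_eq_square
        flip: scaleR_diff_right)
  show "0 < ?f e" if "e \<noteq> 0" for e
    by (rule bellman_positive[OF inj_matrix_vector_mult_nonzero[OF A that]])
qed (use that in blast)

text \<open>Orthogonality to the feature space is the square system
  \<open>?f w = wadj ?q A b\<close>, whose matrix is definite by
  \<open>bellman_positive\<close>.\<close>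

lemma bellman_ex1:
  fixes A :: "real^'l^'n"
  assumes A: "inj ((*v) A)"
  shows "\<exists>!w. \<forall>e. winner (occ \<zeta>0 K) (b + trans_mat K *v (A *v w) - A *v w) (A *v e) = 0"
proof -
  let ?q = "occ \<zeta>0 K"
  let ?f = "\<lambda>w. wadj ?q A (A *v w - trans_mat K *v (A *v w))"
  have "linear (\<lambda>w. A *v w - trans_mat K *v (A *v w))"
    by (rule linear_compose_sub)
       (simp_all add: linear_compose[OF matrix_vector_mul_linear matrix_vector_mul_linear, unfolded o_def])
  then have "linear ?f" using linear_compose[OF _ linear_wadj] by (simp add: o_def)
  moreover have "?f e \<bullet> e \<noteq> 0" if "e \<noteq> 0" for e
    using bellman_positive[OF inj_matrix_vector_mult_nonzero[OF A that]] by (simp add: inner_wadj)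
  ultimately have "\<exists>!w. ?f w = wadj ?q A b" by (rule linear_definite_ex1)
  moreover have "?f w = wadj ?q A b \<longleftrightarrow>
      (\<forall>e. winner ?q (b + trans_mat K *v (A *v w) - A *v w) (A *v e) = 0)" for w
    unfolding vector_eq_rdot[symmetric, of "?f w"] inner_wadj winner_diff_left winner_add_left
    by (auto simp: algebra_simps)
  ultimately show ?thesis by simp
qed

text \<open>The system is solved in block order: the \<open>J\<close> equation alone determines
  \<open>wJ\<close>, after which the \<open>M\<close> equation has a known inhomogeneity. Unique
  solvability gives the description in \<open>td_target\<close> its meaning.\<close>

lemma td_target_orthogonal:
  assumes J: "inj ((*v) (feature_mat \<phi>J))" and M: "inj ((*v) (feature_mat \<phi>M))"
    and w: "td_target \<zeta>0 K r \<phi>J \<phi>M = (wJ, wM)"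
  shows "winner (occ \<zeta>0 K) (r + trans_mat K *v (feature_mat \<phi>J *v wJ) - feature_mat \<phi>J *v wJ)
      (feature_mat \<phi>J *v e) = 0"
    and "winner (occ \<zeta>0 K) (diag_mat r *v r
        + 2 *\<^sub>R (diag_mat r *v (trans_mat K *v (feature_mat \<phi>J *v wJ)))
        + trans_mat K *v (feature_mat \<phi>M *v wM) - feature_mat \<phi>M *v wM)
      (feature_mat \<phi>M *v e') = 0"
proof -
  let ?q = "occ \<zeta>0 K" and ?P = "trans_mat K" and ?J = "feature_mat \<phi>J" and ?M = "feature_mat \<phi>M"
  let ?bM = "\<lambda>wJ. diag_mat r *v r + 2 *\<^sub>R (diag_mat r *v (?P *v (?J *v wJ)))"
  let ?QJ = "\<lambda>wJ. \<forall>e. winner ?q (r + ?P *v (?J *v wJ) - ?J *v wJ) (?J *v e) = 0"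
  let ?QM = "\<lambda>wJ wM. \<forall>e. winner ?q (?bM wJ + ?P *v (?M *v wM) - ?M *v wM) (?M *v e) = 0"
  have iff: "is_td_target \<zeta>0 K r \<phi>J \<phi>M (wJ, wM) \<longleftrightarrow> ?QJ wJ \<and> ?QM wJ wM" for wJ wM
    unfolding is_td_target_def Let_def feature_space_def case_prod_conv
    using wproj_eq_iff[OF occ_pos J] wproj_eq_iff[OF occ_pos M] by simp
  obtain wJ' where wJ': "?QJ wJ'" "\<And>w. ?QJ w \<Longrightarrow> w = wJ'"
    using bellman_ex1[OF J, of r] by (auto simp: Ex1_def)
  obtain wM' where wM': "?QM wJ' wM'" "\<And>w. ?QM wJ' w \<Longrightarrow> w = wM'"
    using bellman_ex1[OF M, of "?bM wJ'"] by (auto simp: Ex1_def)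
  have "\<exists>!w. is_td_target \<zeta>0 K r \<phi>J \<phi>M w"
  proof (rule ex1I[of _ "(wJ', wM')"])
    show "is_td_target \<zeta>0 K r \<phi>J \<phi>M (wJ', wM')" unfolding iff using wJ'(1) wM'(1) by blast
    fix w assume "is_td_target \<zeta>0 K r \<phi>J \<phi>M w"
    then obtain u v where "w = (u, v)" "?QJ u" "?QM u v"
      by (metis iff surj_pair)
    then show "w = (wJ', wM')" using wJ'(2) wM'(2) by blast
  qed
  from theI'[OF this] have "is_td_target \<zeta>0 K r \<phi>J \<phi>M (wJ, wM)"
    unfolding w[unfolded td_target_def] .
  then show "winner ?q (r + ?P *v (?J *v wJ) - ?J *v wJ) (?J *v e) = 0"
    "winner ?q (?bM wJ + ?P *v (?M *v wM) - ?M *v wM) (?M *v e') = 0"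
    unfolding iff by blast+
qed

end

section \<open>Sums along a trajectory\<close>

text \<open>
  \<open>0\<close> on a trajectory that never terminates, so that the sum up to \<open>stop_idx\<close> is then \<open>0\<close>, like
  the sum over an infinite set in \<open>td_iter\<close>.
\<close>

definition stop_idx :: "(nat \<Rightarrow> 'n option) \<Rightarrow> nat" where
  "stop_idx y = (if \<exists>k>0. y k = None then LEAST k. 0 < k \<and> y k = None else 0)"

lemma sum_until_term_time:
  "(\<Sum>t\<in>{t. enat t < term_time y}. g t) = (\<Sum>t<stop_idx y. g t)"
proof (cases "\<exists>k>0. y k = None")
  case True
  let ?P = "\<lambda>k. 0 < k \<and> y k = None"
  have P: "?P (Least ?P)" using True by (rule LeastI_ex)
  have "term_time y = enat (Least ?P)"
    unfolding term_time_def
  proof (rule antisym)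
    show "Inf (enat ` {k. 0 < k \<and> y k = None}) \<le> enat (Least ?P)"
      using P by (intro Inf_lower) auto
    show "enat (Least ?P) \<le> Inf (enat ` {k. 0 < k \<and> y k = None})"
      by (intro Inf_greatest) (auto intro: Least_le)
  qed
  then have "{t. enat t < term_time y} = {..<stop_idx y}"
    using True by (auto simp: stop_idx_def)
  then show ?thesis by simp
next
  case False
  then have "{k. 0 < k \<and> y k = None} = {}" by auto
  then have "term_time y = \<infinity>" by (simp only: term_time_def image_empty Inf_empty top_enat_def)
  moreover have "stop_idx y = 0" using False by (simp only: stop_idx_def if_False)
  ultimately show ?thesis by simp
qed

text \<open>Replaces the random upper limit by a survival test at each time, so that a sum along a
  trajectory becomes a full series.\<close>

lemma stop_idx_alive:
  assumes "y 0 \<noteq> None" and abs: "\<And>t. y t = None \<Longrightarrow> y (Suc t) = None" and ex: "\<exists>t. y t = None"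
  shows "t < stop_idx y \<longleftrightarrow> y t \<noteq> None"
proof -
  let ?P = "\<lambda>k. 0 < k \<and> y k = None"
  obtain k where "y k = None" using ex by blast
  then have "?P k" using assms(1) by (cases k) auto
  then have ex: "\<exists>k>0. y k = None" by blast
  then have N: "stop_idx y = Least ?P" by (simp add: stop_idx_def)
  have P: "?P (Least ?P)" using ex by (rule LeastI_ex)
  have "y s = None" if "Least ?P \<le> s" for s
    using that by (induction s rule: dec_induct) (use P abs in auto)
  moreover have "y s \<noteq> None" if "s < Least ?P" for s
    using not_less_Least[OF that] assms(1) by (cases s) auto
  ultimately show ?thesis unfolding N by (meson not_le)
qed

lemma measurable_stop_idx[measurable]:
  "stop_idx \<in> measurable (PiM UNIV (\<lambda>t::nat. count_space (UNIV :: 'n option set))) (count_space UNIV)"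
proof -
  let ?T = "PiM UNIV (\<lambda>t::nat. count_space (UNIV :: 'n option set))"
  have c: "(\<lambda>y. y k) \<in> measurable ?T (count_space UNIV)" for k
    by (rule measurable_component_singleton) simp
  have [measurable]: "Measurable.pred ?T (\<lambda>y. y k = None)" for k
    using measurable_compose[OF c, of "\<lambda>a. a = None" "count_space UNIV"] by simp
  show ?thesis unfolding stop_idx_def by measurable
qed

context prob_space begin

context
  fixes K :: "'n::finite \<Rightarrow> 'n option pmf" and \<zeta>0 :: "'n pmf"
    and Y :: "nat \<Rightarrow> 'a \<Rightarrow> 'n option"
  assumes chain: "markov_chain M \<zeta>0 K Y"
begin

lemma measurable_chain[measurable]: "Y t \<in> measurable M (count_space UNIV)"
  using chain by (simp add: markov_chain_def)

lemma measurable_stop_idx_chain: "(\<lambda>\<omega>. stop_idx (\<lambda>t. Y t \<omega>)) \<in> measurable M (count_space UNIV)"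
proof -
  have "(\<lambda>\<omega> t. Y t \<omega>) \<in> measurable M (PiM UNIV (\<lambda>t. count_space UNIV))"
    by (rule measurable_PiM_single') (auto simp: measurable_chain)
  from measurable_compose[OF this measurable_stop_idx] show ?thesis .
qed

text \<open>TD increments depend on two consecutive states only, so this marginal of the path laws
  in \<open>markov_chain\<close> determines their means.\<close>

lemma distr_chain_pair:
  "distr M (count_space UNIV) (\<lambda>\<omega>. (Y t \<omega>, Y (Suc t) \<omega>))
    = measure_pmf (bind_pmf (state_pmf \<zeta>0 K t) (\<lambda>a. map_pmf (Pair a) (step K a)))"
proof -
  let ?L = "\<lambda>\<omega>. map (\<lambda>i. Y i \<omega>) [0..<Suc (Suc t)]" and ?p = "\<lambda>xs. (xs ! t, xs ! Suc t)"
  have d: "distr M (count_space UNIV) ?L = measure_pmf (init_path_pmf \<zeta>0 K (Suc t))"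
    using chain unfolding markov_chain_def by blast
  \<comment> \<open>There are countably many lists over a finite type, so preimages of single lists
    suffice.\<close>
  have "?L \<in> measurable M (count_space UNIV)"
    unfolding measurable_count_space_eq2_countable
  proof (intro conjI ballI)
    fix xs
    have "?L -` {xs} \<inter> space M = {\<omega>\<in>space M. length xs = Suc (Suc t) \<and> (\<forall>i<Suc (Suc t). Y i \<omega> = xs ! i)}"
      by (auto simp: list_eq_iff_nth_eq simp del: upt_Suc)
    also have "\<dots> \<in> sets M" by measurable
    finally show "?L -` {xs} \<inter> space M \<in> sets M" .
  qed simp
  then have "distr (distr M (count_space UNIV) ?L) (count_space UNIV) ?p
      = distr M (count_space UNIV) (?p \<circ> ?L)"
    by (intro distr_distr) auto
  moreover have "?p \<circ> ?L = (\<lambda>\<omega>. (Y t \<omega>, Y (Suc t) \<omega>))"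
    by (auto simp: fun_eq_iff nth_append)
  ultimately show ?thesis
    by (simp only: d init_path_pmf_last_step[symmetric] map_pmf_rep_eq)
qed

lemma measurable_chain_pair: "(\<lambda>\<omega>. (Y t \<omega>, Y (Suc t) \<omega>)) \<in> measurable M (count_space UNIV)"
proof -
  have "(\<lambda>\<omega>. (Y t \<omega>, Y (Suc t) \<omega>)) \<in> measurable M (count_space UNIV \<Otimes>\<^sub>M count_space UNIV)"
    by measurable
  then show ?thesis by (simp add: pair_measure_countable)
qed

lemma chain_pair_integral:
  fixes g :: "'n option \<Rightarrow> 'n option \<Rightarrow> real"
  shows "integrable M (\<lambda>\<omega>. g (Y t \<omega>) (Y (Suc t) \<omega>))"
    and "expectation (\<lambda>\<omega>. g (Y t \<omega>) (Y (Suc t) \<omega>))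
      = (\<Sum>a\<in>UNIV. pmf (state_pmf \<zeta>0 K t) a * (\<Sum>b\<in>UNIV. pmf (step K a) b * g a b))"
proof -
  let ?p = "bind_pmf (state_pmf \<zeta>0 K t) (\<lambda>a. map_pmf (Pair a) (step K a))"
  have "integrable (measure_pmf ?p) (\<lambda>(a, b). g a b)"
    by (rule integrable_measure_pmf_finite) simp
  then show "integrable M (\<lambda>\<omega>. g (Y t \<omega>) (Y (Suc t) \<omega>))"
    unfolding distr_chain_pair[symmetric]
    by (subst (asm) integrable_distr_eq) (auto intro: measurable_chain_pair)
  have "expectation (\<lambda>\<omega>. g (Y t \<omega>) (Y (Suc t) \<omega>)) = (\<integral>z. (\<lambda>(a, b). g a b) z \<partial>measure_pmf ?p)"
    unfolding distr_chain_pair[symmetric]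
    by (subst integral_distr) (auto intro: measurable_chain_pair)
  also have "\<dots> = (\<Sum>z\<in>UNIV. (\<lambda>(a, b). g a b) z * pmf ?p z)"
    by (rule integral_measure_pmf_real) auto
  also have "\<dots> = (\<Sum>a\<in>UNIV. \<Sum>b\<in>UNIV. g a b * pmf ?p (a, b))"
    unfolding sum.cartesian_product UNIV_Times_UNIV by (rule sum.cong) auto
  finally show "expectation (\<lambda>\<omega>. g (Y t \<omega>) (Y (Suc t) \<omega>))
      = (\<Sum>a\<in>UNIV. pmf (state_pmf \<zeta>0 K t) a * (\<Sum>b\<in>UNIV. pmf (step K a) b * g a b))"
    by (simp add: pmf_bind_Pair sum_distrib_left mult_ac)
qed

lemma expectation_alive: "expectation (\<lambda>\<omega>. if Y t \<omega> = None then 0 else 1) = alive \<zeta>0 K t"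
proof -
  have "(\<Sum>b\<in>UNIV. pmf (K x) b) = 1" for x by (rule sum_pmf_eq_1) auto
  then have "pmf (K x) None + (\<Sum>b\<in>UNIV. pmf (K x) (Some b)) = 1" for x
    by (simp add: UNIV_option_sum)
  then show ?thesis
    using chain_pair_integral(2)[of "\<lambda>a b. if a = None then 0 else 1" t]
    by (simp add: UNIV_option_sum step_def alive_def occ_at_state)
qed

text \<open>\<open>markov_chain\<close> prescribes laws, not paths, so absorption and termination
  hold only almost surely. Survival forever has probability at most
  \<open>alive \<zeta>0 K t\<close> for every \<open>t\<close>.\<close>

lemma AE_chain_regular:
  assumes "proper K"
  shows "AE \<omega> in M. Y 0 \<omega> \<noteq> None \<and> (\<forall>t. Y t \<omega> = None \<longrightarrow> Y (Suc t) \<omega> = None) \<and> (\<exists>t. Y t \<omega> = None)"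
proof -
  have AE_pair: "AE \<omega> in M. P (Y t \<omega>) (Y (Suc t) \<omega>)"
    if "\<And>a b. a \<in> set_pmf (state_pmf \<zeta>0 K t) \<Longrightarrow> b \<in> set_pmf (step K a) \<Longrightarrow> P a b" for P t
  proof -
    have "AE z in distr M (count_space UNIV) (\<lambda>\<omega>. (Y t \<omega>, Y (Suc t) \<omega>)). case_prod P z"
      unfolding distr_chain_pair using that by (auto simp: AE_measure_pmf_iff)
    then show ?thesis
      by (subst (asm) AE_distr_iff) (auto intro: measurable_chain_pair)
  qed
  have "AE \<omega> in M. Y 0 \<omega> \<noteq> None"
    using AE_pair[of 0 "\<lambda>a b. a \<noteq> None"] by (auto simp: state_pmf_0)
  moreover have "AE \<omega> in M. \<forall>t. Y t \<omega> = None \<longrightarrow> Y (Suc t) \<omega> = None"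
    unfolding AE_all_countable
    by (intro allI AE_pair[of _ "\<lambda>a b. a = None \<longrightarrow> b = None"]) (auto simp: step_def)
  moreover have "AE \<omega> in M. \<exists>t. Y t \<omega> = None"
  proof -
    let ?N = "{\<omega>\<in>space M. \<forall>t. Y t \<omega> \<noteq> None}"
    have N[measurable]: "?N \<in> sets M" by measurable
    have "prob ?N \<le> alive \<zeta>0 K t" for t
    proof -
      have "integrable M (indicator ?N :: 'a \<Rightarrow> real)"
        by (rule integrable_real_indicator[OF N]) (simp add: less_top[symmetric])
      then have i: "integrable M (\<lambda>\<omega>. indicator ?N \<omega> :: real)" .
      have "prob ?N = expectation (indicator ?N)" by simp
      also have "\<dots> \<le> expectation (\<lambda>\<omega>. if Y t \<omega> = None then 0 else 1)"
        using chain_pair_integral(1)[of "\<lambda>a b. if a = None then 0 else 1" t]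
        by (intro integral_mono i) (auto simp: indicator_def)
      finally show ?thesis by (simp only: expectation_alive)
    qed
    then have "prob ?N \<le> 0"
      by (intro LIMSEQ_le_const[OF summable_LIMSEQ_zero[OF alive_summable[OF assms, of \<zeta>0]]]) blast
    then have "prob ?N = 0" by (simp add: measure_le_0_iff)
    then have "AE \<omega> in M. \<omega> \<notin> ?N" using prob_eq_0[OF N] by simp
    with AE_space show ?thesis by eventually_elim auto
  qed
  ultimately show ?thesis by eventually_elim auto
qed

text \<open>As \<open>g\<close> vanishes at \<open>None\<close>, the random-length sum is almost
  surely the whole series. Its terms have absolute means at most
  \<open>c t * alive \<zeta>0 K t\<close>, so sum and expectation may be exchanged. The bound may
  grow with \<open>t\<close>, as the second moment requires.\<close>

lemma trajectory_sum:
  fixes g :: "nat \<Rightarrow> 'n option \<Rightarrow> 'n option \<Rightarrow> real"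
  assumes "proper K" and g0: "\<And>t b. g t None b = 0" and gc: "\<And>t a b. \<bar>g t a b\<bar> \<le> c t"
    and c: "summable (\<lambda>t. c t * alive \<zeta>0 K t)"
  shows "integrable M (\<lambda>\<omega>. \<Sum>t<stop_idx (\<lambda>t. Y t \<omega>). g t (Y t \<omega>) (Y (Suc t) \<omega>))"
    and "expectation (\<lambda>\<omega>. \<Sum>t<stop_idx (\<lambda>t. Y t \<omega>). g t (Y t \<omega>) (Y (Suc t) \<omega>))
      = (\<Sum>t. expectation (\<lambda>\<omega>. g t (Y t \<omega>) (Y (Suc t) \<omega>)))"
proof -
  let ?g = "\<lambda>t \<omega>. g t (Y t \<omega>) (Y (Suc t) \<omega>)"
  let ?S = "\<lambda>\<omega>. \<Sum>t<stop_idx (\<lambda>t. Y t \<omega>). ?g t \<omega>"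
  have int: "integrable M (?g t)" for t by (rule chain_pair_integral)
  have sums: "AE \<omega> in M. summable (\<lambda>t. norm (?g t \<omega>)) \<and> (\<Sum>t. ?g t \<omega>) = ?S \<omega>"
    using AE_chain_regular[OF assms(1)]
  proof eventually_elim
    case (elim \<omega>)
    then have "t < stop_idx (\<lambda>t. Y t \<omega>) \<longleftrightarrow> Y t \<omega> \<noteq> None" for t
      by (intro stop_idx_alive) auto
    then have "?g t \<omega> = 0" if "t \<notin> {..<stop_idx (\<lambda>t. Y t \<omega>)}" for t
      using that g0 by auto
    then show ?case
      by (intro conjI summable_finite[of "{..<stop_idx (\<lambda>t. Y t \<omega>)}"] suminf_finite) auto
  qed
  have norms: "summable (\<lambda>t. expectation (\<lambda>\<omega>. norm (?g t \<omega>)))"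
  proof (rule summable_comparison_test'[OF c])
    fix t :: nat
    let ?i = "\<lambda>\<omega>. if Y t \<omega> = None then 0 else 1 :: real"
    have "expectation (\<lambda>\<omega>. norm (?g t \<omega>)) \<le> expectation (\<lambda>\<omega>. c t * ?i \<omega>)"
      using chain_pair_integral(1)[of "\<lambda>a b. c t * (if a = None then 0 else 1)" t]
      by (intro integral_mono integrable_norm int) (auto simp: g0 gc)
    also have "\<dots> = c t * alive \<zeta>0 K t" by (simp only: integral_mult_right_zero expectation_alive)
    finally show "norm (expectation (\<lambda>\<omega>. norm (?g t \<omega>))) \<le> c t * alive \<zeta>0 K t" by simp
  qed
  have m: "?S \<in> borel_measurable M"
  proof -
    have [measurable]: "(\<lambda>\<omega>. ?g t \<omega>) \<in> borel_measurable M" for t using int by auto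
    show ?thesis
      by (rule measurable_compose_countable[OF _ measurable_stop_idx_chain]) measurable
  qed
  have ae: "AE \<omega> in M. (\<Sum>t. ?g t \<omega>) = ?S \<omega>" using sums by eventually_elim simp
  have sn: "AE \<omega> in M. summable (\<lambda>t. norm (?g t \<omega>))" using sums by eventually_elim simp
  note i = integrable_suminf[OF int sn norms] integral_suminf[OF int sn norms]
  show "integrable M ?S"
    using integrable_cong_AE_imp[OF i(1) m] ae by (simp add: eq_commute)
  have "expectation ?S = expectation (\<lambda>\<omega>. \<Sum>t. ?g t \<omega>)"
    using ae i(1) m by (intro integral_cong_AE) (auto simp: eq_commute)
  then show "expectation ?S = (\<Sum>t. expectation (?g t))" using i(2) by simp
qed

text \<open>This is where the weights \<open>q\<close> enter: summing the laws of \<open>x_t\<close>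
  over all times gives the occupancy.\<close>

lemma stationary_trajectory_sum:
  fixes g :: "'n option \<Rightarrow> 'n option \<Rightarrow> real"
  assumes "proper K" and g0: "\<And>b. g None b = 0"
  shows "integrable M (\<lambda>\<omega>. \<Sum>t<stop_idx (\<lambda>t. Y t \<omega>). g (Y t \<omega>) (Y (Suc t) \<omega>))"
    and "expectation (\<lambda>\<omega>. \<Sum>t<stop_idx (\<lambda>t. Y t \<omega>). g (Y t \<omega>) (Y (Suc t) \<omega>))
      = (\<Sum>s\<in>UNIV. occ \<zeta>0 K s * (\<Sum>b\<in>UNIV. pmf (K s) b * g (Some s) b))"
proof -
  define c where "c = Max (range (\<lambda>(a, b). \<bar>g a b\<bar>))"
  have c: "\<bar>g a b\<bar> \<le> c" for a b
    unfolding c_def by (rule Max_ge) (auto intro!: image_eqI[of _ _ "(a, b)"])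
  note T = trajectory_sum[of "\<lambda>_. g" "\<lambda>_. c", OF assms(1) g0 c summable_mult[OF alive_summable[OF assms(1)]]]
  show "integrable M (\<lambda>\<omega>. \<Sum>t<stop_idx (\<lambda>t. Y t \<omega>). g (Y t \<omega>) (Y (Suc t) \<omega>))"
    by (rule T)
  have "expectation (\<lambda>\<omega>. g (Y t \<omega>) (Y (Suc t) \<omega>))
      = (\<Sum>s\<in>UNIV. occ_at \<zeta>0 K t s * (\<Sum>b\<in>UNIV. pmf (K s) b * g (Some s) b))" for t
    unfolding chain_pair_integral(2)
    by (subst UNIV_option_sum) (simp add: g0 occ_at_state step_def)
  then show "expectation (\<lambda>\<omega>. \<Sum>t<stop_idx (\<lambda>t. Y t \<omega>). g (Y t \<omega>) (Y (Suc t) \<omega>))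
      = (\<Sum>s\<in>UNIV. occ \<zeta>0 K s * (\<Sum>b\<in>UNIV. pmf (K s) b * g (Some s) b))"
    unfolding T(2) occ_def using occ_at_summable[OF assms(1), of \<zeta>0]
    by (simp add: suminf_sum summable_mult2 suminf_mult2)
qed

lemma stop_idx_second_moment:
  assumes "proper K"
  shows "integrable M (\<lambda>\<omega>. (real (stop_idx (\<lambda>t. Y t \<omega>)))\<^sup>2)"
    and "expectation (\<lambda>\<omega>. (real (stop_idx (\<lambda>t. Y t \<omega>)))\<^sup>2) = (\<Sum>t. (2 * real t + 1) * alive \<zeta>0 K t)"
proof -
  define g :: "nat \<Rightarrow> 'n option \<Rightarrow> 'n option \<Rightarrow> real"
    where "g t a b = (2 * real t + 1) * (if a = None then 0 else 1)" for t a b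
  \<comment> \<open>Consecutive odd numbers add up to squares, so the squared length is itself a sum
    along the trajectory.\<close>
  have odd: "(\<Sum>t<n. 2 * real t + 1) = (real n)\<^sup>2" for n
    by (induction n) (auto simp: power2_eq_square algebra_simps)
  note T = trajectory_sum[of g "\<lambda>t. 2 * real t + 1", OF assms _ _ alive_moment_summable[OF assms]]
  have T1: "integrable M (\<lambda>\<omega>. \<Sum>t<stop_idx (\<lambda>t. Y t \<omega>). g t (Y t \<omega>) (Y (Suc t) \<omega>))"
    and T2: "expectation (\<lambda>\<omega>. \<Sum>t<stop_idx (\<lambda>t. Y t \<omega>). g t (Y t \<omega>) (Y (Suc t) \<omega>))
      = (\<Sum>t. expectation (\<lambda>\<omega>. g t (Y t \<omega>) (Y (Suc t) \<omega>)))"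
    by (rule T; simp add: g_def)+
  let ?N2 = "\<lambda>\<omega>. (real (stop_idx (\<lambda>t. Y t \<omega>)))\<^sup>2"
  have sq: "AE \<omega> in M. (\<Sum>t<stop_idx (\<lambda>t. Y t \<omega>). g t (Y t \<omega>) (Y (Suc t) \<omega>)) = ?N2 \<omega>"
    using AE_chain_regular[OF assms]
  proof eventually_elim
    case (elim \<omega>)
    then have "t < stop_idx (\<lambda>t. Y t \<omega>) \<longleftrightarrow> Y t \<omega> \<noteq> None" for t
      by (intro stop_idx_alive) auto
    then show ?case unfolding odd[symmetric] by (intro sum.cong) (auto simp: g_def)
  qed
  have [measurable]: "?N2 \<in> borel_measurable M"
    using measurable_compose[OF measurable_stop_idx_chain, of "\<lambda>n. (real n)\<^sup>2" borel] by simp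
  show "integrable M ?N2"
    by (rule integrable_cong_AE_imp[OF T1]) (use sq in \<open>auto simp: eq_commute\<close>)
  have "expectation ?N2 = expectation (\<lambda>\<omega>. \<Sum>t<stop_idx (\<lambda>t. Y t \<omega>). g t (Y t \<omega>) (Y (Suc t) \<omega>))"
    using sq T1 by (intro integral_cong_AE) (auto simp: eq_commute)
  then show "expectation ?N2 = (\<Sum>t. (2 * real t + 1) * alive \<zeta>0 K t)"
    unfolding T2 unfolding g_def integral_mult_right_zero expectation_alive .
qed

end

end

section \<open>TD(0)\<close>

definition td_dir_J :: "real^'n \<Rightarrow> ('n \<Rightarrow> real^'j) \<Rightarrow> (nat \<Rightarrow> 'n option) \<Rightarrow> real^'j \<Rightarrow> real^'j" where
  "td_dir_J r \<phi>J y wJ = (\<Sum>t<stop_idx y. delta_J r \<phi>J y t wJ *\<^sub>R feature_at \<phi>J (y t))"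

definition td_dir_M ::
  "real^'n \<Rightarrow> ('n \<Rightarrow> real^'j) \<Rightarrow> ('n \<Rightarrow> real^'m) \<Rightarrow> (nat \<Rightarrow> 'n option) \<Rightarrow> real^'j \<Rightarrow> real^'m \<Rightarrow> real^'m"
  where
  "td_dir_M r \<phi>J \<phi>M y wJ wM = (\<Sum>t<stop_idx y. delta_M r \<phi>J \<phi>M y t wJ wM *\<^sub>R feature_at \<phi>M (y t))"

definition td_update ::
  "real^'n \<Rightarrow> ('n \<Rightarrow> real^'j) \<Rightarrow> ('n \<Rightarrow> real^'m) \<Rightarrow> real \<Rightarrow> (real^'j) \<times> (real^'m)
    \<Rightarrow> (nat \<Rightarrow> 'n option) \<Rightarrow> (real^'j) \<times> (real^'m)" where
  "td_update r \<phi>J \<phi>M c w y =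
    (fst w + c *\<^sub>R td_dir_J r \<phi>J y (fst w), snd w + c *\<^sub>R td_dir_M r \<phi>J \<phi>M y (fst w) (snd w))"

text \<open>One whole trajectory is one input, so the independence of trajectories is exactly what
  the abstract recursion asks for.\<close>

lemma td_iter_eq_drive:
  "td_iter r \<phi>J \<phi>M \<xi> w0 x k = drive (\<lambda>k. td_update r \<phi>J \<phi>M (\<xi> k)) w0 x k"
  by (induction k)
     (simp_all add: td_update_def td_dir_J_def td_dir_M_def Let_def case_prod_beta sum_until_term_time)

lemma measurable_td_update:
  fixes r :: "real^'n::finite"
  shows "(\<lambda>(w, y). td_update r \<phi>J \<phi>M c w y)
    \<in> measurable (borel \<Otimes>\<^sub>M PiM UNIV (\<lambda>t::nat. count_space UNIV)) borel"
proof -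
  let ?B = "borel \<Otimes>\<^sub>M PiM UNIV (\<lambda>t::nat. count_space (UNIV :: 'n option set))"
  have coord: "(\<lambda>z. f (snd z t)) \<in> borel_measurable ?B" for f :: "'n option \<Rightarrow> 'x::topological_space" and t
  proof -
    have "(\<lambda>z. snd z t) \<in> measurable ?B (count_space UNIV)"
      by (rule measurable_compose[OF measurable_snd measurable_component_singleton]) simp
    from measurable_compose[OF this, of f borel] show ?thesis by simp
  qed
  have [measurable]: "(\<lambda>z. feature_at \<phi>J (snd z t)) \<in> borel_measurable ?B"
    "(\<lambda>z. feature_at \<phi>M (snd z t)) \<in> borel_measurable ?B"
    "(\<lambda>z. reward_at r (snd z t)) \<in> borel_measurable ?B" for t
    by (rule coord)+
  have "fst \<in> borel_measurable borel" "snd \<in> borel_measurable borel"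
    by (auto intro!: borel_measurable_continuous_onI continuous_intros)
  then have [measurable]: "(\<lambda>z. fst (fst z)) \<in> borel_measurable ?B"
    "(\<lambda>z. snd (fst z)) \<in> borel_measurable ?B"
    by (auto intro: measurable_compose[OF measurable_fst])
  have idx: "(\<lambda>z. stop_idx (snd z)) \<in> measurable ?B (count_space UNIV)"
    by (rule measurable_compose[OF measurable_snd measurable_stop_idx])
  have [measurable]: "(\<lambda>z. td_dir_J r \<phi>J (snd z) (fst (fst z))) \<in> borel_measurable ?B"
    unfolding td_dir_J_def delta_J_def
    by (rule measurable_compose_countable[OF _ idx]) measurable
  have [measurable]: "(\<lambda>z. td_dir_M r \<phi>J \<phi>M (snd z) (fst (fst z)) (snd (fst z))) \<in> borel_measurable ?B"
    unfolding td_dir_M_def delta_M_def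
    by (rule measurable_compose_countable[OF _ idx]) measurable
  show ?thesis unfolding td_update_def case_prod_beta by measurable
qed

lemma feature_mat_vec: "(feature_mat \<phi> *v w) $ s = \<phi> s \<bullet> w"
  by (simp add: feature_mat_def matrix_vector_mult_def inner_vec_def)

lemma diag_mat_vec: "(diag_mat r *v v) $ s = r $ s * v $ s"
  by (simp add: diag_mat_def matrix_vector_mult_def if_distrib[of "\<lambda>a. a * _"] cong: if_cong)

text \<open>The constant is averaged over all successors, including termination; the feature term
  loses the terminal one because features are 0 there. Hence the substochastic \<open>P\<close>
  appears.\<close>

lemma pmf_feature_sum:
  fixes K :: "'n::finite \<Rightarrow> 'n option pmf"
  shows "(\<Sum>b\<in>UNIV. pmf (K s) b * (c + d * (feature_at \<phi> b \<bullet> w)))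
    = c + d * (trans_mat K *v (feature_mat \<phi> *v w)) $ s"
proof -
  have "(\<Sum>b\<in>UNIV. pmf (K s) b) = 1" by (rule sum_pmf_eq_1) auto
  moreover have "(\<Sum>b\<in>UNIV. pmf (K s) b * (feature_at \<phi> b \<bullet> w))
      = (trans_mat K *v (feature_mat \<phi> *v w)) $ s"
    by (simp add: UNIV_option_sum feature_at_def trans_mat_vec feature_mat_vec)
  moreover have "(\<Sum>b\<in>UNIV. pmf (K s) b * (c + d * (feature_at \<phi> b \<bullet> w)))
      = c * (\<Sum>b\<in>UNIV. pmf (K s) b) + d * (\<Sum>b\<in>UNIV. pmf (K s) b * (feature_at \<phi> b \<bullet> w))"
    unfolding sum_distrib_left sum.distrib[symmetric] by (intro sum.cong) (auto simp: algebra_simps)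
  ultimately show ?thesis by simp
qed

context prob_space begin

text \<open>The mean direction is tested against an arbitrary \<open>e\<close>, which keeps the
  integrals real and produces the orthogonality expression that vanishes at the target.\<close>

lemma td_dir_J_mean:
  fixes K :: "'n::finite \<Rightarrow> 'n option pmf"
  assumes chain: "markov_chain M \<zeta>0 K Y" and "proper K"
  shows "integrable M (\<lambda>\<omega>. td_dir_J r \<phi> (\<lambda>t. Y t \<omega>) w \<bullet> e)"
    and "expectation (\<lambda>\<omega>. td_dir_J r \<phi> (\<lambda>t. Y t \<omega>) w \<bullet> e)
      = winner (occ \<zeta>0 K) (r + trans_mat K *v (feature_mat \<phi> *v w) - feature_mat \<phi> *v w)
          (feature_mat \<phi> *v e)"
proof -
  define g where "g a b = (reward_at r a + (feature_at \<phi> b - feature_at \<phi> a) \<bullet> w) * (feature_at \<phi> a \<bullet> e)"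
    for a b
  have eq: "td_dir_J r \<phi> (\<lambda>t. Y t \<omega>) w \<bullet> e = (\<Sum>t<stop_idx (\<lambda>t. Y t \<omega>). g (Y t \<omega>) (Y (Suc t) \<omega>))" for \<omega>
    by (simp add: td_dir_J_def delta_J_def g_def inner_sum_left)
  have g0: "g None b = 0" for b by (simp add: g_def feature_at_def)
  note T = stationary_trajectory_sum[where g=g, OF chain \<open>proper K\<close> g0]
  show "integrable M (\<lambda>\<omega>. td_dir_J r \<phi> (\<lambda>t. Y t \<omega>) w \<bullet> e)" unfolding eq by (rule T)
  have "(\<Sum>b\<in>UNIV. pmf (K s) b * g (Some s) b)
      = (r + trans_mat K *v (feature_mat \<phi> *v w) - feature_mat \<phi> *v w) $ s * (feature_mat \<phi> *v e) $ s" for s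
  proof -
    have "(\<Sum>b\<in>UNIV. pmf (K s) b * g (Some s) b)
      = (\<Sum>b\<in>UNIV. pmf (K s) b * ((r $ s - \<phi> s \<bullet> w) + 1 * (feature_at \<phi> b \<bullet> w))) * (\<phi> s \<bullet> e)"
      unfolding sum_distrib_right
      by (intro sum.cong) (auto simp: g_def reward_at_def feature_at_def inner_diff_left algebra_simps)
    then show ?thesis unfolding pmf_feature_sum by (simp add: feature_mat_vec algebra_simps)
  qed
  then show "expectation (\<lambda>\<omega>. td_dir_J r \<phi> (\<lambda>t. Y t \<omega>) w \<bullet> e)
      = winner (occ \<zeta>0 K) (r + trans_mat K *v (feature_mat \<phi> *v w) - feature_mat \<phi> *v w)
          (feature_mat \<phi> *v e)"
    unfolding eq T(2) winner_def by (simp add: mult.assoc)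
qed

lemma td_dir_M_mean:
  fixes K :: "'n::finite \<Rightarrow> 'n option pmf"
  assumes chain: "markov_chain M \<zeta>0 K Y" and "proper K"
  shows "integrable M (\<lambda>\<omega>. td_dir_M r \<phi>J \<phi>M (\<lambda>t. Y t \<omega>) wJ wM \<bullet> e)"
    and "expectation (\<lambda>\<omega>. td_dir_M r \<phi>J \<phi>M (\<lambda>t. Y t \<omega>) wJ wM \<bullet> e)
      = winner (occ \<zeta>0 K) (diag_mat r *v r
          + 2 *\<^sub>R (diag_mat r *v (trans_mat K *v (feature_mat \<phi>J *v wJ)))
          + trans_mat K *v (feature_mat \<phi>M *v wM) - feature_mat \<phi>M *v wM) (feature_mat \<phi>M *v e)"
      (is "_ = winner _ ?v _")
proof -
  define g where "g a b = ((reward_at r a)\<^sup>2 + 2 * reward_at r a * (feature_at \<phi>J b \<bullet> wJ)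
      + (feature_at \<phi>M b - feature_at \<phi>M a) \<bullet> wM) * (feature_at \<phi>M a \<bullet> e)"
    for a b
  have eq: "td_dir_M r \<phi>J \<phi>M (\<lambda>t. Y t \<omega>) wJ wM \<bullet> e
      = (\<Sum>t<stop_idx (\<lambda>t. Y t \<omega>). g (Y t \<omega>) (Y (Suc t) \<omega>))" for \<omega>
    by (simp add: td_dir_M_def delta_M_def g_def inner_sum_left)
  have g0: "g None b = 0" for b by (simp add: g_def feature_at_def)
  note T = stationary_trajectory_sum[where g=g, OF chain \<open>proper K\<close> g0]
  show "integrable M (\<lambda>\<omega>. td_dir_M r \<phi>J \<phi>M (\<lambda>t. Y t \<omega>) wJ wM \<bullet> e)" unfolding eq by (rule T)
  have "(\<Sum>b\<in>UNIV. pmf (K s) b * g (Some s) b) = ?v $ s * (feature_mat \<phi>M *v e) $ s" for s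
  proof -
    have "(\<Sum>b\<in>UNIV. pmf (K s) b * g (Some s) b)
      = ((\<Sum>b\<in>UNIV. pmf (K s) b * (((r $ s)\<^sup>2 - \<phi>M s \<bullet> wM) + (2 * r $ s) * (feature_at \<phi>J b \<bullet> wJ)))
        + (\<Sum>b\<in>UNIV. pmf (K s) b * (0 + 1 * (feature_at \<phi>M b \<bullet> wM)))) * (\<phi>M s \<bullet> e)"
      unfolding sum.distrib[symmetric] sum_distrib_right
      by (intro sum.cong) (auto simp: g_def reward_at_def feature_at_def inner_diff_left algebra_simps)
    then show ?thesis
      unfolding pmf_feature_sum by (simp add: feature_mat_vec diag_mat_vec power2_eq_square algebra_simps)
  qed
  then show "expectation (\<lambda>\<omega>. td_dir_M r \<phi>J \<phi>M (\<lambda>t. Y t \<omega>) wJ wM \<bullet> e)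
      = winner (occ \<zeta>0 K) ?v (feature_mat \<phi>M *v e)"
    unfolding eq T(2) winner_def by (simp add: mult.assoc)
qed

end

section \<open>Growth bounds and the one-step drift\<close>

lemma finite_norm_bound:
  fixes f :: "'a::finite \<Rightarrow> 'b::real_normed_vector"
  obtains B where "0 \<le> B" "\<And>a. norm (f a) \<le> B"
proof (rule that[of "\<Sum>a\<in>UNIV. norm (f a)"])
  show "norm (f a) \<le> (\<Sum>a\<in>UNIV. norm (f a))" for a
    by (rule member_le_sum) auto
qed (simp add: sum_nonneg)

text \<open>States are finitely many, so rewards and features are bounded and each summand is affine
  in the weights. Both bounds use the same right-hand side in order to share one constant
  \<open>A\<close>.\<close>

lemma td_dir_bounds:
  fixes r :: "real^'n::finite" and \<phi>J :: "'n \<Rightarrow> real^'j" and \<phi>M :: "'n \<Rightarrow> real^'m"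
  obtains A where "0 \<le> A"
    "\<And>y wJ (wM :: real^'m). norm (td_dir_J r \<phi>J y wJ) \<le> A * (1 + norm wJ + norm wM) * real (stop_idx y)"
    "\<And>y wJ wM. norm (td_dir_M r \<phi>J \<phi>M y wJ wM) \<le> A * (1 + norm wJ + norm wM) * real (stop_idx y)"
proof -
  obtain R where R: "0 \<le> R" "\<And>a. norm (reward_at r a) \<le> R" using finite_norm_bound[of "reward_at r"] by metis
  obtain J where J: "0 \<le> J" "\<And>a. norm (feature_at \<phi>J a) \<le> J" using finite_norm_bound[of "feature_at \<phi>J"] by metis
  obtain F where F: "0 \<le> F" "\<And>a. norm (feature_at \<phi>M a) \<le> F" using finite_norm_bound[of "feature_at \<phi>M"] by metis
  have diff: "\<bar>(u - v) \<bullet> w\<bar> \<le> 2 * C * norm w" if "norm u \<le> C" "norm v \<le> C" for u v w :: "real^'x" and C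
  proof -
    have "\<bar>(u - v) \<bullet> w\<bar> \<le> norm (u - v) * norm w" by (rule Cauchy_Schwarz_ineq2)
    also have "\<dots> \<le> (2 * C) * norm w"
      using norm_triangle_ineq4[of u v] that by (intro mult_right_mono) auto
    finally show ?thesis .
  qed
  let ?aJ = "(R + 2 * J) * J" and ?aM = "(R\<^sup>2 + 2 * R * J + 2 * F) * F"
  have dJ: "norm (delta_J r \<phi>J y t wJ *\<^sub>R feature_at \<phi>J (y t)) \<le> (R + 2 * J) * (1 + norm wJ + norm wM) * J"
    for y t wJ and wM :: "real^'m"
  proof -
    have "\<bar>delta_J r \<phi>J y t wJ\<bar> \<le> R + 2 * J * norm wJ"
      unfolding delta_J_def using R(2)[of "y t"] diff[OF J(2) J(2), of "y (Suc t)" "y t" wJ] by simp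
    also have "\<dots> \<le> (R + 2 * J) * (1 + norm wJ + norm wM)"
      using R(1) J(1) by (simp add: algebra_simps add_nonneg_nonneg)
    finally have *: "\<bar>delta_J r \<phi>J y t wJ\<bar> \<le> (R + 2 * J) * (1 + norm wJ + norm wM)" .
    then show ?thesis using J R(1) by (simp add: mult_mono)
  qed
  have dM: "norm (delta_M r \<phi>J \<phi>M y t wJ wM *\<^sub>R feature_at \<phi>M (y t))
      \<le> (R\<^sup>2 + 2 * R * J + 2 * F) * (1 + norm wJ + norm wM) * F" for y t wJ wM
  proof -
    have "(reward_at r (y t))\<^sup>2 \<le> R\<^sup>2"
      using R(2)[of "y t"] by (simp add: abs_le_square_iff[symmetric])
    moreover have "\<bar>2 * reward_at r (y t) * (feature_at \<phi>J (y (Suc t)) \<bullet> wJ)\<bar> \<le> 2 * R * J * norm wJ"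
    proof -
      have "\<bar>feature_at \<phi>J (y (Suc t)) \<bullet> wJ\<bar> \<le> J * norm wJ"
        by (rule order_trans[OF Cauchy_Schwarz_ineq2]) (intro mult_right_mono J norm_ge_zero)
      then have "\<bar>reward_at r (y t)\<bar> * \<bar>feature_at \<phi>J (y (Suc t)) \<bullet> wJ\<bar> \<le> R * (J * norm wJ)"
        using R J(1) by (intro mult_mono) auto
      then show ?thesis by (simp add: abs_mult)
    qed
    ultimately have "\<bar>delta_M r \<phi>J \<phi>M y t wJ wM\<bar> \<le> R\<^sup>2 + 2 * R * J * norm wJ + 2 * F * norm wM"
      unfolding delta_M_def using diff[OF F(2) F(2), of "y (Suc t)" "y t" wM] zero_le_power2[of "reward_at r (y t)"]
      by linarith
    also have "\<dots> \<le> (R\<^sup>2 + 2 * R * J + 2 * F) * (1 + norm wJ + norm wM)"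
      using R(1) J(1) F(1) by (simp add: algebra_simps add_nonneg_nonneg)
    finally have *: "\<bar>delta_M r \<phi>J \<phi>M y t wJ wM\<bar> \<le> (R\<^sup>2 + 2 * R * J + 2 * F) * (1 + norm wJ + norm wM)" .
    then show ?thesis using F R(1) J(1) by (simp add: mult_mono)
  qed
  have sum_bound: "norm (\<Sum>t<n. f t) \<le> (?aJ + ?aM) * s * real n"
    if "\<And>t. norm (f t) \<le> a * s * C" "a * C \<le> ?aJ + ?aM" "0 \<le> s" for f :: "nat \<Rightarrow> real^'x" and a s C n
  proof -
    have "norm (\<Sum>t<n. f t) \<le> (\<Sum>t<n. a * s * C)" by (rule sum_norm_le) (rule that(1))
    also have "\<dots> = (a * C) * s * real n" by simp
    also have "\<dots> \<le> (?aJ + ?aM) * s * real n" using that by (intro mult_right_mono) auto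
    finally show ?thesis .
  qed
  have nn: "0 \<le> ?aJ" "0 \<le> ?aM" using R(1) J(1) F(1) by simp_all
  show ?thesis
  proof (rule that[of "?aJ + ?aM"])
    show "norm (td_dir_J r \<phi>J y wJ) \<le> (?aJ + ?aM) * (1 + norm wJ + norm wM) * real (stop_idx y)"
      for y wJ and wM :: "real^'m"
      unfolding td_dir_J_def by (rule sum_bound[OF dJ]) (use nn in auto)
    show "norm (td_dir_M r \<phi>J \<phi>M y wJ wM) \<le> (?aJ + ?aM) * (1 + norm wJ + norm wM) * real (stop_idx y)"
      for y wJ wM
      unfolding td_dir_M_def by (rule sum_bound[OF dM]) (use nn in auto)
  qed (use nn in auto)
qed

text \<open>\<open>\<kappa>\<close> is chosen so that
  \<open>\<kappa> * D\<^sup>2 \<le> cJ * cM\<close>; the weighted cross term then costs at most half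
  of each diagonal term, whence the factor 1/2. The \<open>+ 1\<close> in the denominator covers
  \<open>D = 0\<close>.\<close>

lemma block_triangular_lyapunov:
  fixes a b cJ cM D :: real
  assumes "0 < cJ" "0 < cM"
    and mJ: "mJ \<le> - cJ * a\<^sup>2" and mM: "mM \<le> D * a * b - cM * b\<^sup>2"
  defines "\<kappa> \<equiv> cJ * cM / (D\<^sup>2 + 1)"
  shows "mJ + \<kappa> * mM \<le> - (min cJ cM / 2) * (a\<^sup>2 + \<kappa> * b\<^sup>2)"
proof -
  have \<kappa>: "0 < \<kappa>" "\<kappa> * D\<^sup>2 \<le> cJ * cM"
  proof -
    have "D\<^sup>2 + 1 > 0" by (smt (verit) zero_le_power2)
    then show "0 < \<kappa>" using assms by (simp add: \<kappa>_def)
    have "D\<^sup>2 / (D\<^sup>2 + 1) \<le> 1" using \<open>D\<^sup>2 + 1 > 0\<close> by (simp add: divide_le_eq)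
    then have "(cJ * cM) * (D\<^sup>2 / (D\<^sup>2 + 1)) \<le> (cJ * cM) * 1" using assms by (intro mult_left_mono) auto
    then show "\<kappa> * D\<^sup>2 \<le> cJ * cM" by (simp add: \<kappa>_def)
  qed
  \<comment> \<open>Young's inequality, balanced so that the \<open>b\<close> part is half of the
    available \<open>cM * b\<^sup>2\<close>.\<close>
  have "0 \<le> (D * a - cM * b)\<^sup>2" by simp
  then have "2 * cM * (D * a * b) \<le> D\<^sup>2 * a\<^sup>2 + cM\<^sup>2 * b\<^sup>2"
    by (simp add: power2_diff power_mult_distrib algebra_simps)
  then have "2 * cM * (D * a * b - cM * b\<^sup>2) \<le> D\<^sup>2 * a\<^sup>2 - cM\<^sup>2 * b\<^sup>2"
    by (simp add: algebra_simps power2_eq_square)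
  then have "\<kappa> * (2 * cM * (D * a * b - cM * b\<^sup>2)) \<le> \<kappa> * (D\<^sup>2 * a\<^sup>2 - cM\<^sup>2 * b\<^sup>2)"
    using \<kappa> by (intro mult_left_mono) auto
  also have "\<dots> \<le> cJ * cM * a\<^sup>2 - \<kappa> * cM\<^sup>2 * b\<^sup>2"
    using mult_right_mono[OF \<kappa>(2), of "a\<^sup>2"] by (simp add: algebra_simps)
  finally have "cM * (2 * (\<kappa> * (D * a * b - cM * b\<^sup>2))) \<le> cM * (cJ * a\<^sup>2 - \<kappa> * cM * b\<^sup>2)"
    by (simp add: algebra_simps power2_eq_square)
  then have "2 * (\<kappa> * (D * a * b - cM * b\<^sup>2)) \<le> cJ * a\<^sup>2 - \<kappa> * cM * b\<^sup>2"
    using assms(2) by (simp add: mult_le_cancel_left_pos)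
  moreover have "\<kappa> * mM \<le> \<kappa> * (D * a * b - cM * b\<^sup>2)" using \<kappa> mM by (intro mult_left_mono) auto
  ultimately have "2 * (mJ + \<kappa> * mM) \<le> - (cJ * a\<^sup>2) - cM * (\<kappa> * b\<^sup>2)"
    using mJ by (simp add: algebra_simps)
  moreover have "min cJ cM * a\<^sup>2 \<le> cJ * a\<^sup>2" "min cJ cM * (\<kappa> * b\<^sup>2) \<le> cM * (\<kappa> * b\<^sup>2)"
    using \<kappa> by (auto intro!: mult_right_mono)
  ultimately show ?thesis by (simp add: algebra_simps)
qed

text \<open>Turns growth in the norm of the weights into growth in the Lyapunov function. The 3
  comes from squaring three summands, and \<open>1 + 1 / \<kappa>\<close> compensates for the weight
  on \<open>b\<close>.\<close>

lemma affine_growth: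
  fixes a b s \<kappa> :: real
  assumes "0 \<le> a" "0 \<le> b" "1 \<le> s" "0 < \<kappa>"
  shows "(s + a + b)\<^sup>2 \<le> 3 * s\<^sup>2 * (1 + 1 / \<kappa>) * (1 + (a\<^sup>2 + \<kappa> * b\<^sup>2))"
proof -
  have "0 \<le> (s - a)\<^sup>2 + (s - b)\<^sup>2 + (a - b)\<^sup>2" by simp
  then have "(s + a + b)\<^sup>2 \<le> 3 * (s\<^sup>2 + a\<^sup>2 + b\<^sup>2)"
    by (simp add: power2_eq_square algebra_simps)
  also have "\<dots> \<le> 3 * (s\<^sup>2 * (1 + a\<^sup>2 + b\<^sup>2))"
  proof -
    have "1 \<le> s\<^sup>2" using assms by simp
    then have "1 * (a\<^sup>2 + b\<^sup>2) \<le> s\<^sup>2 * (a\<^sup>2 + b\<^sup>2)" by (intro mult_right_mono) auto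
    then show ?thesis by (simp add: algebra_simps)
  qed
  also have "\<dots> \<le> 3 * (s\<^sup>2 * ((1 + 1 / \<kappa>) * (1 + (a\<^sup>2 + \<kappa> * b\<^sup>2))))"
  proof -
    have "(1 + 1 / \<kappa>) * (1 + (a\<^sup>2 + \<kappa> * b\<^sup>2)) = 1 + a\<^sup>2 + b\<^sup>2 + (\<kappa> * b\<^sup>2 + (1 + a\<^sup>2) / \<kappa>)"
      using assms(4) by (simp add: field_simps)
    moreover have "0 \<le> \<kappa> * b\<^sup>2 + (1 + a\<^sup>2) / \<kappa>" using assms(4) by simp
    ultimately have "1 + a\<^sup>2 + b\<^sup>2 \<le> (1 + 1 / \<kappa>) * (1 + (a\<^sup>2 + \<kappa> * b\<^sup>2))" by linarith
    then show ?thesis by (intro mult_left_mono) auto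
  qed
  finally show ?thesis by (simp add: mult.assoc)
qed

definition td_error ::
  "real \<Rightarrow> 'a::real_normed_vector \<Rightarrow> 'b::real_normed_vector \<Rightarrow> 'a \<times> 'b \<Rightarrow> real" where
  "td_error \<kappa> uJ uM w = (norm (fst w - uJ))\<^sup>2 + \<kappa> * (norm (snd w - uM))\<^sup>2"

text \<open>The squared norms are expanded around \<open>w\<close>: the linear term is controlled by
  the mean drift, the quadratic one by linear growth and the second moment of the trajectory length.
  The constants do not depend on \<open>Y\<close>, \<open>\<xi>\<close> or \<open>w\<close>.\<close>

lemma (in prob_space) td_drift:
  fixes K :: "'n::finite \<Rightarrow> 'n option pmf" and r :: "real^'n"
    and \<phi>J :: "'n \<Rightarrow> real^'j" and \<phi>M :: "'n \<Rightarrow> real^'m"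
  assumes proper: "proper K" and occ_pos: "\<And>s. 0 < occ \<zeta>0 K s"
    and J: "inj ((*v) (feature_mat \<phi>J))" and F: "inj ((*v) (feature_mat \<phi>M))"
    and target: "td_target \<zeta>0 K r \<phi>J \<phi>M = (uJ, uM)"
  obtains \<kappa> c C where "0 < \<kappa>" "0 < c" "c\<^sup>2 \<le> C"
    "\<And>Y \<xi> w. markov_chain M \<zeta>0 K Y \<Longrightarrow> 0 < \<xi> \<Longrightarrow>
      (\<integral>\<^sup>+\<omega>. ennreal (td_error \<kappa> uJ uM (td_update r \<phi>J \<phi>M \<xi> w (\<lambda>t. Y t \<omega>))) \<partial>M)
      \<le> ennreal ((1 - 2 * c * \<xi> + C * \<xi>\<^sup>2) * td_error \<kappa> uJ uM w + C * \<xi>\<^sup>2)"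
proof -
  let ?q = "occ \<zeta>0 K" and ?P = "trans_mat K" and ?J = "feature_mat \<phi>J" and ?F = "feature_mat \<phi>M"
  obtain cJ where cJ: "0 < cJ" "\<And>e. cJ * (norm e)\<^sup>2 \<le> winner ?q (?J *v e - ?P *v (?J *v e)) (?J *v e)"
    using bellman_coercive[OF proper occ_pos J] by metis
  obtain cM where cM: "0 < cM" "\<And>e. cM * (norm e)\<^sup>2 \<le> winner ?q (?F *v e - ?P *v (?F *v e)) (?F *v e)"
    using bellman_coercive[OF proper occ_pos F] by metis
  \<comment> \<open>The coupling: an error in \<open>wJ\<close> enters the \<open>M\<close> equation
    only through this linear map, whose operator bound is \<open>D\<close>.\<close>
  let ?L = "\<lambda>e. 2 *\<^sub>R (diag_mat r *v (?P *v (?J *v e)))"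
  have lin: "linear (\<lambda>e. wadj ?q ?F (?L e))"
    by (rule linearI)
       (simp_all add: matrix_vector_right_distrib matrix_vector_mult_scaleR scaleR_right_distrib
         linear_add[OF linear_wadj] linear_cmul[OF linear_wadj])
  then obtain D where D: "\<And>e. norm (wadj ?q ?F (?L e)) \<le> D * norm e"
    using linear_bounded_pos by metis
  have cross: "winner ?q (?L e) (?F *v e') \<le> D * norm e * norm e'" for e e'
  proof -
    have "winner ?q (?L e) (?F *v e') = wadj ?q ?F (?L e) \<bullet> e'" by (simp only: inner_wadj)
    also have "\<dots> \<le> norm (wadj ?q ?F (?L e)) * norm e'" by (rule norm_cauchy_schwarz)
    also have "\<dots> \<le> D * norm e * norm e'" using D by (intro mult_right_mono) auto
    finally show ?thesis .
  qed
  define \<kappa> where "\<kappa> = cJ * cM / (D\<^sup>2 + 1)"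
  have \<kappa>: "0 < \<kappa>"
    using cJ(1) cM(1) by (simp add: \<kappa>_def add_nonneg_pos)
  define c where "c = min cJ cM / 2"
  have c: "0 < c" using cJ(1) cM(1) by (simp add: c_def)
  define V where "V = td_error \<kappa> uJ uM"
  have V: "V w = (norm (fst w - uJ))\<^sup>2 + \<kappa> * (norm (snd w - uM))\<^sup>2" for w
    by (simp add: V_def td_error_def)
  have V0: "0 \<le> V w" for w using \<kappa> by (simp add: V)
  obtain A where A: "0 \<le> A"
    "\<And>y wJ (wM :: real^'m). norm (td_dir_J r \<phi>J y wJ) \<le> A * (1 + norm wJ + norm wM) * real (stop_idx y)"
    "\<And>y wJ wM. norm (td_dir_M r \<phi>J \<phi>M y wJ wM) \<le> A * (1 + norm wJ + norm wM) * real (stop_idx y)"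
    using td_dir_bounds[of r \<phi>J \<phi>M] by metis
  define E2 where "E2 = (\<Sum>t. (2 * real t + 1) * alive \<zeta>0 K t)"
  define s where "s = 1 + norm uJ + norm uM"
  define G where "G = (1 + \<kappa>) * A\<^sup>2 * (3 * s\<^sup>2 * (1 + 1 / \<kappa>))"
  have G: "0 \<le> G" using \<kappa> by (simp add: G_def)
  \<comment> \<open>\<open>G * E2\<close> is the quadratic term; the maximum with
    \<open>c\<^sup>2\<close> secures \<open>2 * c * \<xi> \<le> 1 + C * \<xi>\<^sup>2\<close> for
    all step sizes.\<close>
  define C where "C = max (c\<^sup>2) (G * E2)"
  have growth: "(norm (td_dir_J r \<phi>J y (fst w)))\<^sup>2 + \<kappa> * (norm (td_dir_M r \<phi>J \<phi>M y (fst w) (snd w)))\<^sup>2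
      \<le> G * (1 + V w) * (real (stop_idx y))\<^sup>2" for y w
  proof -
    let ?n = "1 + norm (fst w) + norm (snd w)" and ?N = "real (stop_idx y)"
    have "(norm (td_dir_J r \<phi>J y (fst w)))\<^sup>2 \<le> (A * ?n * ?N)\<^sup>2"
      "(norm (td_dir_M r \<phi>J \<phi>M y (fst w) (snd w)))\<^sup>2 \<le> (A * ?n * ?N)\<^sup>2"
      by (intro power_mono A norm_ge_zero)+
    then have "(norm (td_dir_J r \<phi>J y (fst w)))\<^sup>2 + \<kappa> * (norm (td_dir_M r \<phi>J \<phi>M y (fst w) (snd w)))\<^sup>2
      \<le> (A * ?n * ?N)\<^sup>2 + \<kappa> * (A * ?n * ?N)\<^sup>2"
      using \<kappa> by (intro add_mono mult_left_mono) auto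
    also have "\<dots> = (1 + \<kappa>) * (A * ?n * ?N)\<^sup>2" by (simp only: distrib_right mult_1)
    also have "\<dots> = (1 + \<kappa>) * A\<^sup>2 * ?N\<^sup>2 * ?n\<^sup>2" by (simp only: power_mult_distrib mult_ac)
    also have "\<dots> \<le> (1 + \<kappa>) * A\<^sup>2 * ?N\<^sup>2 * (3 * s\<^sup>2 * (1 + 1 / \<kappa>) * (1 + V w))"
    proof (intro mult_left_mono)
      have "norm (fst w) \<le> norm uJ + norm (fst w - uJ)" "norm (snd w) \<le> norm uM + norm (snd w - uM)"
        using norm_triangle_sub by blast+
      then have "?n \<le> s + norm (fst w - uJ) + norm (snd w - uM)" by (simp add: s_def)
      then have "?n\<^sup>2 \<le> (s + norm (fst w - uJ) + norm (snd w - uM))\<^sup>2" by (intro power_mono) auto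
      also have "\<dots> \<le> 3 * s\<^sup>2 * (1 + 1 / \<kappa>) * (1 + V w)"
        unfolding V by (rule affine_growth) (use \<kappa> in \<open>auto simp: s_def\<close>)
      finally show "?n\<^sup>2 \<le> 3 * s\<^sup>2 * (1 + 1 / \<kappa>) * (1 + V w)" .
    qed (use \<kappa> in auto)
    also have "\<dots> = G * (1 + V w) * ?N\<^sup>2" by (simp add: G_def mult_ac)
    finally show ?thesis .
  qed
  have drift: "(\<integral>\<^sup>+\<omega>. ennreal (V (td_update r \<phi>J \<phi>M \<xi> w (\<lambda>t. Y t \<omega>))) \<partial>M)
      \<le> ennreal ((1 - 2 * c * \<xi> + C * \<xi>\<^sup>2) * V w + C * \<xi>\<^sup>2)"
    if Y: "markov_chain M \<zeta>0 K Y" and \<xi>: "0 < \<xi>" for Y \<xi> w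
  proof -
    let ?eJ = "fst w - uJ" and ?eM = "snd w - uM" and ?y = "\<lambda>\<omega> t. Y t \<omega>"
    let ?N = "\<lambda>\<omega>. real (stop_idx (?y \<omega>))"
    let ?hJ = "\<lambda>\<omega>. td_dir_J r \<phi>J (?y \<omega>) (fst w) \<bullet> ?eJ"
    let ?hM = "\<lambda>\<omega>. td_dir_M r \<phi>J \<phi>M (?y \<omega>) (fst w) (snd w) \<bullet> ?eM"
    have fw: "fst w = uJ + ?eJ" "snd w = uM + ?eM" by simp_all
    have mJ: "expectation ?hJ \<le> - cJ * (norm ?eJ)\<^sup>2"
    proof -
      have "expectation ?hJ = winner ?q (r + ?P *v (?J *v fst w) - ?J *v fst w) (?J *v ?eJ)"
        by (rule td_dir_J_mean[OF Y proper])
      \<comment> \<open>The affine mean field is split into its value at the target, which is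
        orthogonal to the features, and a part linear in the error.\<close>
      also have "r + ?P *v (?J *v fst w) - ?J *v fst w
          = (r + ?P *v (?J *v uJ) - ?J *v uJ) - (?J *v ?eJ - ?P *v (?J *v ?eJ))"
        by (subst (1 2) fw(1)) (simp only: matrix_vector_right_distrib algebra_simps)
      finally show ?thesis
        using cJ(2)[of ?eJ]
        by (simp add: winner_diff_left[of _ "r + _ - _"] td_target_orthogonal[OF proper occ_pos J F target])
    qed
    have mM: "expectation ?hM \<le> D * norm ?eJ * norm ?eM - cM * (norm ?eM)\<^sup>2"
    proof -
      let ?v = "\<lambda>wJ wM. diag_mat r *v r + 2 *\<^sub>R (diag_mat r *v (?P *v (?J *v wJ)))
          + ?P *v (?F *v wM) - ?F *v wM"
      have "expectation ?hM = winner ?q (?v (fst w) (snd w)) (?F *v ?eM)"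
        by (rule td_dir_M_mean[OF Y proper])
      also have "?v (fst w) (snd w) = ?v uJ uM + ?L ?eJ - (?F *v ?eM - ?P *v (?F *v ?eM))"
        by (subst fw(1), subst (1 2) fw(2)) (simp only: matrix_vector_right_distrib scaleR_right_distrib algebra_simps)
      also have "winner ?q (?v uJ uM + ?L ?eJ - (?F *v ?eM - ?P *v (?F *v ?eM))) (?F *v ?eM)
          = 0 + winner ?q (?L ?eJ) (?F *v ?eM) - winner ?q (?F *v ?eM - ?P *v (?F *v ?eM)) (?F *v ?eM)"
        unfolding winner_diff_left[of _ "?v uJ uM + ?L ?eJ"] winner_add_left[of _ "?v uJ uM"]
        by (simp only: td_target_orthogonal(2)[OF proper occ_pos J F target])
      finally show ?thesis using cM(2)[of ?eM] cross[of ?eJ ?eM] by linarith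
    qed
    have mean: "expectation ?hJ + \<kappa> * expectation ?hM \<le> - c * V w"
      unfolding c_def V \<kappa>_def by (rule block_triangular_lyapunov[OF cJ(1) cM(1) mJ mM])
    let ?B = "\<lambda>\<omega>. V w + 2 * \<xi> * (?hJ \<omega> + \<kappa> * ?hM \<omega>) + \<xi>\<^sup>2 * (G * (1 + V w)) * (?N \<omega>)\<^sup>2"
    have le: "V (td_update r \<phi>J \<phi>M \<xi> w (?y \<omega>)) \<le> ?B \<omega>" for \<omega>
    proof -
      have sq: "(norm (z + \<xi> *\<^sub>R g - u))\<^sup>2 = (norm (z - u))\<^sup>2 + 2 * \<xi> * (g \<bullet> (z - u)) + \<xi>\<^sup>2 * (norm g)\<^sup>2"
        for z u g :: "real^'x"
        unfolding power2_norm_eq_inner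
        by (simp add: inner_add_left inner_add_right inner_diff_left inner_diff_right inner_commute
            power2_eq_square algebra_simps)
      have "V (td_update r \<phi>J \<phi>M \<xi> w (?y \<omega>)) = V w + 2 * \<xi> * (?hJ \<omega> + \<kappa> * ?hM \<omega>)
        + \<xi>\<^sup>2 * ((norm (td_dir_J r \<phi>J (?y \<omega>) (fst w)))\<^sup>2
            + \<kappa> * (norm (td_dir_M r \<phi>J \<phi>M (?y \<omega>) (fst w) (snd w)))\<^sup>2)"
        unfolding V td_update_def fst_conv snd_conv sq by (simp add: distrib_left mult_ac)
      also have "\<dots> \<le> V w + 2 * \<xi> * (?hJ \<omega> + \<kappa> * ?hM \<omega>) + \<xi>\<^sup>2 * (G * (1 + V w) * (?N \<omega>)\<^sup>2)"
        by (intro add_left_mono mult_left_mono growth) simp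
      finally show ?thesis by (simp add: mult.assoc)
    qed
    note int[simp] = td_dir_J_mean(1)[OF Y proper] td_dir_M_mean(1)[OF Y proper] stop_idx_second_moment(1)[OF Y proper]
    have "(\<integral>\<^sup>+\<omega>. ennreal (V (td_update r \<phi>J \<phi>M \<xi> w (?y \<omega>))) \<partial>M) \<le> (\<integral>\<^sup>+\<omega>. ennreal (?B \<omega>) \<partial>M)"
      by (intro nn_integral_mono ennreal_leI le)
    \<comment> \<open>\<open>?hJ\<close> and \<open>?hM\<close> change sign, but \<open>?B\<close>
      dominates \<open>V\<close> and is therefore nonnegative.\<close>
    also have "\<dots> = ennreal (expectation ?B)"
      by (rule nn_integral_eq_integral) (auto intro: order_trans[OF V0 le])
    also have "expectation ?B
        = V w + 2 * \<xi> * (expectation ?hJ + \<kappa> * expectation ?hM) + \<xi>\<^sup>2 * (G * (1 + V w)) * E2"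
      by (simp add: prob_space stop_idx_second_moment(2)[OF Y proper] E2_def)
    also have "ennreal \<dots> \<le> ennreal ((1 - 2 * c * \<xi> + C * \<xi>\<^sup>2) * V w + C * \<xi>\<^sup>2)"
    proof (rule ennreal_leI)
      have "2 * \<xi> * (expectation ?hJ + \<kappa> * expectation ?hM) \<le> 2 * \<xi> * (- c * V w)"
        using mean \<xi> by (intro mult_left_mono) auto
      moreover have "(\<xi>\<^sup>2 * (1 + V w)) * (G * E2) \<le> (\<xi>\<^sup>2 * (1 + V w)) * C"
        using V0[of w] by (intro mult_left_mono) (auto simp: C_def)
      ultimately show "V w + 2 * \<xi> * (expectation ?hJ + \<kappa> * expectation ?hM) + \<xi>\<^sup>2 * (G * (1 + V w)) * E2
          \<le> (1 - 2 * c * \<xi> + C * \<xi>\<^sup>2) * V w + C * \<xi>\<^sup>2"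
        by (simp add: algebra_simps)
    qed
    finally show ?thesis .
  qed
  show ?thesis
    by (rule that[OF \<kappa> c _ drift[unfolded V_def]]) (auto simp: C_def)
qed

theorem theorem10:
  fixes M :: "'a measure"
    and K :: "'n::finite \<Rightarrow> 'n option pmf"
    and \<zeta>0 :: "'n pmf"
    and r :: "real^'n"
    and \<phi>J :: "'n \<Rightarrow> real^'j"
    and \<phi>M :: "'n \<Rightarrow> real^'m"
    and \<xi> :: "nat \<Rightarrow> real"
    and wJ0 :: "real^'j" and wM0 :: "real^'m"
    and x :: "nat \<Rightarrow> nat \<Rightarrow> 'a \<Rightarrow> 'n option"
  assumes "prob_space M"
    and "proper K"
    and "rank (feature_mat \<phi>J) = CARD('j)"
    and "rank (feature_mat \<phi>M) = CARD('m)"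
    and "\<And>s. occ \<zeta>0 K s > 0"
    and "\<And>k. \<xi> k > 0"
    and "filterlim (\<lambda>N. \<Sum>k<N. \<xi> k) at_top sequentially"
    and "summable (\<lambda>k. (\<xi> k)\<^sup>2)"
    and "\<And>k. markov_chain M \<zeta>0 K (x k)"
    and "prob_space.indep_vars M (\<lambda>k. PiM UNIV (\<lambda>t::nat. count_space UNIV))
           (\<lambda>k \<omega> t. x k t \<omega>) UNIV"
  shows "AE \<omega> in M.
    (\<lambda>k. fst (td_iter r \<phi>J \<phi>M \<xi> (wJ0, wM0) (\<lambda>i t. x i t \<omega>) k))
      \<longlonglongrightarrow> fst (td_target \<zeta>0 K r \<phi>J \<phi>M) \<and>
    (\<lambda>k. snd (td_iter r \<phi>J \<phi>M \<xi> (wJ0, wM0) (\<lambda>i t. x i t \<omega>) k))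
      \<longlonglongrightarrow> snd (td_target \<zeta>0 K r \<phi>J \<phi>M)"
proof -
  interpret prob_space M by fact
  obtain uJ uM where target: "td_target \<zeta>0 K r \<phi>J \<phi>M = (uJ, uM)" by fastforce
  have inj: "inj ((*v) (feature_mat \<phi>J))" "inj ((*v) (feature_mat \<phi>M))"
    using assms(3,4) by (simp_all add: full_rank_injective[symmetric])
  obtain \<kappa> c C where \<kappa>: "0 < \<kappa>" and c: "0 < c" and C: "c\<^sup>2 \<le> C"
    and drift: "\<And>Y \<xi> w. markov_chain M \<zeta>0 K Y \<Longrightarrow> 0 < \<xi> \<Longrightarrow>
      (\<integral>\<^sup>+\<omega>. ennreal (td_error \<kappa> uJ uM (td_update r \<phi>J \<phi>M \<xi> w (\<lambda>t. Y t \<omega>))) \<partial>M)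
      \<le> ennreal ((1 - 2 * c * \<xi> + C * \<xi>\<^sup>2) * td_error \<kappa> uJ uM w + C * \<xi>\<^sup>2)"
    by (rule td_drift[OF assms(2,5) inj target]) (rule that)
  define V where "V = td_error \<kappa> uJ uM"
  have V: "V w = (norm (fst w - uJ))\<^sup>2 + \<kappa> * (norm (snd w - uM))\<^sup>2" for w
    by (simp add: V_def td_error_def)
  have C0: "0 \<le> C" using C zero_le_power2[of c] by linarith
  have "\<not> summable \<xi>"
  proof
    assume "summable \<xi>"
    then have "(\<Sum>k<N. \<xi> k) \<le> suminf \<xi>" for N
      using assms(6) by (intro sum_le_suminf) (auto simp: less_imp_le)
    moreover have "\<forall>\<^sub>F N in sequentially. suminf \<xi> + 1 \<le> (\<Sum>k<N. \<xi> k)"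
      using assms(7) by (simp add: filterlim_at_top)
    then obtain N where "suminf \<xi> + 1 \<le> (\<Sum>k<N. \<xi> k)"
      using eventually_happens by force
    moreover have "(\<Sum>k<N. \<xi> k) \<le> suminf \<xi>" by fact
    ultimately show False by linarith
  qed
  then have a: "\<not> summable (\<lambda>k. 2 * c * \<xi> k)"
    using c by (subst summable_cmult_iff) auto
  have "AE \<omega> in M. (\<lambda>k. V (drive (\<lambda>k. td_update r \<phi>J \<phi>M (\<xi> k)) (wJ0, wM0) (\<lambda>i t. x i t \<omega>) k)) \<longlonglongrightarrow> 0"
  proof (rule lyapunov_tendsto_0[OF assms(10) measurable_td_update])
    show "V \<in> borel_measurable borel"
      unfolding V by (intro borel_measurable_continuous_onI continuous_intros)
    show "0 \<le> V w" for w using \<kappa> by (simp add: V)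
    show "0 \<le> 2 * c * \<xi> k" for k using c assms(6)[of k] by simp
    show "\<not> summable (\<lambda>k. 2 * c * \<xi> k)" by (rule a)
    show "0 \<le> C * (\<xi> k)\<^sup>2" for k using C0 by simp
    show "summable (\<lambda>k. C * (\<xi> k)\<^sup>2)" by (rule summable_mult[OF assms(8)])
    \<comment> \<open>Here \<open>c\<^sup>2 \<le> C\<close> is used; it spares any smallness
      condition on the early steps.\<close>
    show "2 * c * \<xi> k \<le> 1 + C * (\<xi> k)\<^sup>2" for k
    proof -
      have "0 \<le> (1 - c * \<xi> k)\<^sup>2" by simp
      then have "2 * c * \<xi> k \<le> 1 + c\<^sup>2 * (\<xi> k)\<^sup>2"
        by (simp add: power2_diff power_mult_distrib algebra_simps)
      also have "\<dots> \<le> 1 + C * (\<xi> k)\<^sup>2" using C by (simp add: mult_right_mono)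
      finally show ?thesis .
    qed
    show "(\<integral>\<^sup>+\<omega>. ennreal (V (td_update r \<phi>J \<phi>M (\<xi> k) w (\<lambda>t. x k t \<omega>))) \<partial>M)
      \<le> ennreal ((1 - 2 * c * \<xi> k + C * (\<xi> k)\<^sup>2) * V w + C * (\<xi> k)\<^sup>2)" for k w
      unfolding V_def by (rule drift[OF assms(9) assms(6)])
  qed simp
  then show ?thesis
  proof eventually_elim
    case (elim \<omega>)
    let ?w = "\<lambda>k. td_iter r \<phi>J \<phi>M \<xi> (wJ0, wM0) (\<lambda>i t. x i t \<omega>) k"
    have V0: "(\<lambda>k. V (?w k)) \<longlonglongrightarrow> 0" using elim by (simp add: td_iter_eq_drive)
    \<comment> \<open>Each block error is at most a constant times \<open>V\<close>: the constant is
      1 for \<open>J\<close> and \<open>1 / \<kappa>\<close> for \<open>M\<close>.\<close>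
    have lim: "(\<lambda>k. f (?w k)) \<longlonglongrightarrow> u" if "\<And>w. (norm (f w - u))\<^sup>2 \<le> b * V w"
      for f :: "_ \<Rightarrow> real^'x" and u b
    proof -
      have "(\<lambda>k. b * V (?w k)) \<longlonglongrightarrow> 0" using tendsto_mult_right_zero[OF V0] .
      then have "(\<lambda>k. (norm (f (?w k) - u))\<^sup>2) \<longlonglongrightarrow> 0"
        by (rule tendsto_sandwich[OF _ _ tendsto_const, rotated -1]) (simp_all add: that)
      then have "(\<lambda>k. sqrt ((norm (f (?w k) - u))\<^sup>2)) \<longlonglongrightarrow> sqrt 0" by (rule tendsto_real_sqrt)
      then show ?thesis by (simp add: LIM_zero_iff tendsto_norm_zero_iff)
    qed
    have "(\<lambda>k. fst (?w k)) \<longlonglongrightarrow> uJ"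
      by (rule lim[of _ _ 1]) (use \<kappa> in \<open>simp add: V\<close>)
    moreover have "(\<lambda>k. snd (?w k)) \<longlonglongrightarrow> uM"
      by (rule lim[of _ _ "1 / \<kappa>"]) (use \<kappa> in \<open>simp add: V field_simps\<close>)
    ultimately show ?case by (simp add: target)
  qed
qed

end
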